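(* Let $m,n$ be positive integers, let $k$ be an integer with $0\le k\le\min(m,n)$, and let $x_1,\dots,x_k$ be integers with $1\le x_1<\cdots<x_k\le m$. Let $q,u_1,\dots,u_n,w_1,\dots,w_{m+n-k}$ be independent indeterminates. Then the following identity of rational functions holds: \begin{align*} &F_{m+n-k,n}(u_1,\dots,u_n|w_1,\dots,w_{m+n-k}|x_1,\dots,x_k,m+1,\dots,m+n-k)\\ =&\sum_{1\le y_1<y_2<\cdots<y_{n-k}\le n}\ \sum_{a_1=1}^{y_1}\ \sum_{\substack{a_2=1\\ a_2\ne a_1}}^{y_2}\cdots \sum_{\substack{a_{n-k}=1\\ a_{n-k}\ne a_1,\dots,a_{n-k-1}}}^{y_{n-k}} \left(\prod_{j=1}^{n-k}\prod_{i=1}^m (u_{a_j}-w_i)\right)\\ &\times \frac{\displaystyle\prod_{j=1}^{n-k}\ \prod_{\substack{b=1\\ b\ne a_1,\dots,a_{j-1}}}^{y_j-1}(u_{a_j}-q u_b)} {\displaystyle\prod_{j=1}^{n-k}\ \prod_{\substack{b=1\\ b\ne a_1,\dots,a_j}}^{y_j}(u_{a_j}-u_b)}\\ &\times \overline{F}_{n,n-k}(w_{m+1},\dots,w_{m+n-k}|u_1,\dots,u_n|y_1,\dots,y_{n-k})\\ &\times F_{m,k}\big(\{u_1,\dots,u_n\}\setminus\{u_{a_1},\dots,u_{a_{n-k}}\}\,\big|\,w_1,\dots,w_m\,\big|\,x_1,\dots,x_k\big). \end{align*}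
   Context: Notation: $S_r$ denotes the symmetric group on $\{1,\dots,r\}$. Empty products are equal to $1$. For integers $M\ge r\ge 0$ and integers $1\le x_1<\cdots<x_r\le M$, define $$ F_{M,r}(u_1,\dots,u_r|w_1,\dots,w_M|x_1,\dots,x_r)=\sum_{\sigma\in S_r}\ \prod_{j=1}^r\prod_{i=x_j+1}^{M}(u_{\sigma(j)}-qw_i)\prod_{1\le i<j\le r}\frac{qu_{\sigma(i)}-u_{\sigma(j)}}{u_{\sigma(i)}-u_{\sigma(j)}}\ \prod_{j=1}^r\prod_{i=1}^{x_j-1}(u_{\sigma(j)}-w_i)\ \prod_{j=1}^r(1-q)u_{\sigma(j)} . $$ This function is symmetric in $u_1,\dots,u_r$, so it may be evaluated at a set of $r$ variables; for $r=0$ it equals $1$. For integers $1\le y_1<\cdots<y_{n-k}\le n$, define $$ \overline{F}_{n,n-k}(w_{m+1},\dots,w_{m+n-k}|u_1,\dots,u_n|y_1,\dots,y_{n-k})=\sum_{\sigma\in S_{n-k}}\ \prod_{j=1}^{n-k}\prod_{i=y_j+1}^{n}q(u_i-w_{m+\sigma(j)})\prod_{1\le i<j\le n-k}\frac{qw_{m+\sigma(i)}-w_{m+\sigma(j)}}{q(w_{m+\sigma(i)}-w_{m+\sigma(j)})}\ \prod_{j=1}^{n-k}\prod_{i=1}^{y_j-1}(u_i-qw_{m+\sigma(j)})\ \prod_{j=1}^{n-k}(1-q)u_{y_j}. $$ When $n-k=0$, the sums over the $y_j$ and $a_j$ are understood to consist of the single empty choice. *)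

theory Defs
  imports
    "HOL-Library.Poly_Mapping"
    "HOL-Library.FuncSet"
    "HOL-Combinatorics.Permutations"
    "HOL-Computational_Algebra.Fraction_Field"
begin

section \<open>Rational functions in the indeterminates $q$, $u_i$, $w_i$\<close>

datatype var = Q | U nat | W nat

text \<open>The linear order on the variables is only there to make the polynomial ring
  an instance of \<^class>\<open>idom\<close>; its choice is irrelevant.\<close>

fun var_code :: "var \<Rightarrow> nat" where
  "var_code Q = 0"
| "var_code (U i) = 2 * i + 1"
| "var_code (W i) = 2 * i + 2"

lemma var_code_inject: "var_code a = var_code b \<longleftrightarrow> a = b"
  by (cases a; cases b; simp; presburger)

instantiation var :: linorder
begin

definition less_eq_var :: "var \<Rightarrow> var \<Rightarrow> bool" where
  "less_eq_var a b \<longleftrightarrow> var_code a \<le> var_code b"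

definition less_var :: "var \<Rightarrow> var \<Rightarrow> bool" where
  "less_var a b \<longleftrightarrow> var_code a < var_code b"

instance
  by standard (auto simp: less_eq_var_def less_var_def var_code_inject)

end

text \<open>Monomials are finitely supported exponent maps, polynomials are finitely supported
  coefficient maps on monomials.\<close>

type_synonym 'c ratfun = "((var \<Rightarrow>\<^sub>0 nat) \<Rightarrow>\<^sub>0 'c) fract"

definition indet :: "var \<Rightarrow> 'c::field ratfun" where
  "indet v = Fract (Poly_Mapping.single (Poly_Mapping.single v 1) 1) 1"


section \<open>The functions $F$ and $\overline{F}$\<close>

text \<open>Families are functions on \<^typ>\<open>nat\<close>, of which only the entries with index at least
  1 and within the relevant range are used.\<close>

definition F ::
  "'a::field \<Rightarrow> nat \<Rightarrow> nat \<Rightarrow> (nat \<Rightarrow> 'a) \<Rightarrow> (nat \<Rightarrow> 'a) \<Rightarrow> (nat \<Rightarrow> nat) \<Rightarrow> 'a" where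
  "F q M r u w x =
    (\<Sum>\<sigma> | \<sigma> permutes {1..r}.
       (\<Prod>j\<in>{1..r}. \<Prod>i\<in>{x j + 1..M}. u (\<sigma> j) - q * w i)
     * (\<Prod>(i, j)\<in>{(i, j). 1 \<le> i \<and> i < j \<and> j \<le> r}.
          (q * u (\<sigma> i) - u (\<sigma> j)) / (u (\<sigma> i) - u (\<sigma> j)))
     * (\<Prod>j\<in>{1..r}. \<Prod>i\<in>{1..<x j}. u (\<sigma> j) - w i)
     * (\<Prod>j\<in>{1..r}. (1 - q) * u (\<sigma> j)))"

text \<open>$F$ evaluated at the set of variables $\{u_s : s \in S\}$, where $S$ has $r$ elements.
  The variables are inserted in increasing order of their indices; by \<open>F_on_eq\<close> below
  every other order gives the same value.\<close>

definition F_on ::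
  "'a::field \<Rightarrow> nat \<Rightarrow> nat \<Rightarrow> nat set \<Rightarrow> (nat \<Rightarrow> 'a) \<Rightarrow> (nat \<Rightarrow> 'a) \<Rightarrow> (nat \<Rightarrow> nat) \<Rightarrow> 'a" where
  "F_on q M r S u w x = F q M r (\<lambda>j. u (sorted_list_of_set S ! (j - 1))) w x"

text \<open>The argument \<open>v\<close> stands for the shifted family $v_j = w_{m+j}$.\<close>

definition Fbar ::
  "'a::field \<Rightarrow> nat \<Rightarrow> nat \<Rightarrow> (nat \<Rightarrow> 'a) \<Rightarrow> (nat \<Rightarrow> 'a) \<Rightarrow> (nat \<Rightarrow> nat) \<Rightarrow> 'a" where
  "Fbar q n r v u y =
    (\<Sum>\<sigma> | \<sigma> permutes {1..r}.
       (\<Prod>j\<in>{1..r}. \<Prod>i\<in>{y j + 1..n}. q * (u i - v (\<sigma> j)))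
     * (\<Prod>(i, j)\<in>{(i, j). 1 \<le> i \<and> i < j \<and> j \<le> r}.
          (q * v (\<sigma> i) - v (\<sigma> j)) / (q * (v (\<sigma> i) - v (\<sigma> j))))
     * (\<Prod>j\<in>{1..r}. \<Prod>i\<in>{1..<y j}. u i - q * v (\<sigma> j))
     * (\<Prod>j\<in>{1..r}. (1 - q) * u (y j)))"

lemma F_cong:
  assumes "\<And>j. j \<in> {1..r} \<Longrightarrow> u j = u' j"
  shows "F q M r u w x = F q M r u' w x"
proof -
  have e: "u (\<sigma> j) = u' (\<sigma> j)" if "\<sigma> permutes {1..r}" "j \<in> {1..r}" for \<sigma> j
    using assms permutes_in_image[OF that(1)] that(2) by blast
  show ?thesis
    unfolding F_def
    by (intro sum.cong refl arg_cong2[where f = "(*)"] prod.cong) (auto simp: e)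
qed

lemma F_symmetric:
  assumes "\<tau> permutes {1..r}"
  shows "F q M r (u \<circ> \<tau>) w x = F q M r u w x"
  unfolding F_def
  by (rule trans[OF _ setum_permutations_compose_left[OF assms, symmetric]]) simp

lemma F_on_eq:
  assumes e: "bij_betw e {1..r} S"
  shows "F_on q M r S u w x = F q M r (\<lambda>j. u (e j)) w x"
proof -
  have fin: "finite S" and card: "card S = r"
    using bij_betw_finite[OF e] bij_betw_same_card[OF e] by auto
  define s where "s = (\<lambda>j. sorted_list_of_set S ! (j - 1))"
  have "bij_betw (\<lambda>j. j - 1) {1..r} {..<r}"
    by (rule bij_betw_byWitness[where f' = Suc]) auto
  moreover have "bij_betw ((!) (sorted_list_of_set S)) {..<r} S"
    by (rule bij_betw_nth) (use fin card in auto)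
  ultimately have s: "bij_betw s {1..r} S"
    using bij_betw_trans unfolding s_def comp_def by fastforce
  define \<tau> where "\<tau> = (\<lambda>j. if j \<in> {1..r} then inv_into {1..r} e (s j) else j)"
  have "bij_betw (inv_into {1..r} e \<circ> s) {1..r} {1..r}"
    using s bij_betw_inv_into[OF e] bij_betw_trans by blast
  then have "bij_betw \<tau> {1..r} {1..r}"
    by (rule bij_betw_cong[THEN iffD1, rotated]) (auto simp: \<tau>_def)
  then have \<tau>: "\<tau> permutes {1..r}"
    by (rule bij_imp_permutes) (auto simp: \<tau>_def)
  have "e (\<tau> j) = s j" if "j \<in> {1..r}" for j
    using that s e by (auto simp: \<tau>_def bij_betw_def f_inv_into_f)
  then have "F_on q M r S u w x = F q M r ((\<lambda>j. u (e j)) \<circ> \<tau>) w x"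
    unfolding F_on_def by (intro F_cong) (auto simp: s_def)
  then show ?thesis by (simp only: F_symmetric[OF \<tau>])
qed


section \<open>Summation ranges\<close>

definition incr_seqs :: "nat \<Rightarrow> nat \<Rightarrow> (nat \<Rightarrow> nat) set" where
  "incr_seqs d n = {y \<in> {1..d} \<rightarrow>\<^sub>E {1..n}. strict_mono_on {1..d} y}"

definition dist_seqs :: "nat \<Rightarrow> (nat \<Rightarrow> nat) \<Rightarrow> (nat \<Rightarrow> nat) set" where
  "dist_seqs d y = {a \<in> (\<Pi>\<^sub>E j\<in>{1..d}. {1..y j}). inj_on a {1..d}}"

end

theory Submission
  imports
    Defs
    "HOL-Computational_Algebra.Polynomial"
    "HOL-Combinatorics.Multiset_Permutations"
begin

text \<open>
  The left-hand side is split according to the set \<open>A\<close> of those rows (indices of \<open>u\<close>) which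
  occupy the last \<open>d = n - k\<close> sites. The sum over permutations defining \<open>F\<close> then factorizes
  (\<open>symmetrization_append\<close>): the remaining rows contribute \<open>F\<^bsub>m,k\<^esub>\<close>, and since the last \<open>d\<close>
  sites are consecutive, the rows in \<open>A\<close> contribute the factors \<open>u\<^sub>a - w\<^sub>i\<close> with \<open>i \<le> m\<close> and the
  partition function \<open>Z\<close> (here \<open>dwpf\<close>) of the six-vertex model with domain wall boundary, in the rows
  \<open>A\<close> and the last \<open>d\<close> columns. So the left-hand side is the sum over \<open>A\<close> of
  \<open>split_weight A * \<Phi> A\<close>, where \<open>\<Phi>\<close> collects everything that depends on the first \<open>m\<close> columns
  (\<open>F_full_tail\<close>).

  The right-hand side depends on these columns only through \<open>\<Phi>\<close> of the set of the
  \<open>a\<^sub>j\<close>. The two sides agree for every function \<open>\<Phi>\<close> (\<open>sum_paths_eq_sum_subsets\<close>), and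
  this is proved by induction on \<open>n\<close>, that is by adding one row with variable \<open>x = u\<^sub>n\<close>. If \<open>n\<close>
  does not occur among the \<open>y\<^sub>j\<close>, the new row only multiplies \<open>Fbar\<close> by a factor; if it does, it is
  the last \<open>y\<^sub>j\<close>, and the summand of \<open>Fbar\<close> loses one column and \<open>a\<close> its last entry.
  Comparing the coefficients of \<open>\<Phi> A\<close> leaves two identities for \<open>Z\<close>: for \<open>n \<in> A\<close> the expansion
  of \<open>Z\<close> along the row \<open>x\<close> as a sum over columns (\<open>dwpf_row_expansion\<close>), while \<open>Z\<close> is defined as a
  sum over rows; and for \<open>n \<notin> A\<close> a relation between \<open>Z\<close> of \<open>A\<close> and \<open>Z\<close> of the sets
  obtained from \<open>A\<close> by exchanging one row for \<open>x\<close> (\<open>dwpf_eliminate_row\<close>).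

  Both identities are proved by interpolation. After multiplication with the product of the
  \<open>x - a\<close> over the other rows \<open>a \<in> A\<close>, and in the first case division by \<open>x\<close>, the difference of the
  two sides is a polynomial in \<open>x\<close> of degree at most \<open>2 * card A\<close>. It
  vanishes when \<open>x\<close> is one of the other row variables, because residues cancel, and
  when \<open>x\<close> is one of the column variables, because \<open>Z\<close> is symmetric in the columns and
  its defining sum along the column \<open>x\<close> reduces to a single term. In the second identity these
  are one zero too few, and \<open>x = 0\<close> is the missing one.
\<close>


section \<open>Polynomial functions of bounded degree\<close>

definition polyfun :: "nat \<Rightarrow> ('a::field \<Rightarrow> 'a) \<Rightarrow> bool" where
  "polyfun N f \<longleftrightarrow> (\<exists>p. degree p \<le> N \<and> f = poly p)"

lemma polyfun_const: "polyfun N (\<lambda>x. c)"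
  unfolding polyfun_def by (rule exI[of _ "[:c:]"]) auto

lemma polyfun_linear: "polyfun (Suc 0) (\<lambda>x. b * x + c)"
  unfolding polyfun_def by (rule exI[of _ "[:c, b:]"]) (auto simp: fun_eq_iff)

lemma polyfun_linears:
  "polyfun (Suc 0) (\<lambda>x. x - c)" "polyfun (Suc 0) (\<lambda>x. b * x - c)" "polyfun (Suc 0) (\<lambda>x. c - x)"
  using polyfun_linear[of 1 "-c"] polyfun_linear[of b "-c"] polyfun_linear[of "-1" c] by simp_all

lemma polyfun_mono: "polyfun N f \<Longrightarrow> N \<le> M \<Longrightarrow> polyfun M f"
  unfolding polyfun_def using order_trans by blast

lemma polyfun_add: "polyfun N f \<Longrightarrow> polyfun N g \<Longrightarrow> polyfun N (\<lambda>x. f x + g x)"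
  unfolding polyfun_def
proof (elim exE conjE)
  fix p r :: "'a poly" assume "degree p \<le> N" "f = poly p" "degree r \<le> N" "g = poly r"
  then show "\<exists>p. degree p \<le> N \<and> (\<lambda>x. f x + g x) = poly p"
    by (intro exI[of _ "p + r"]) (auto intro: degree_add_le)
qed

lemma polyfun_mult: "polyfun N f \<Longrightarrow> polyfun M g \<Longrightarrow> polyfun (N + M) (\<lambda>x. f x * g x)"
  unfolding polyfun_def
proof (elim exE conjE)
  fix p r :: "'a poly" assume *: "degree p \<le> N" "f = poly p" "degree r \<le> M" "g = poly r"
  then have "degree (p * r) \<le> N + M"
    using degree_mult_le[of p r] by linarith
  with * show "\<exists>p. degree p \<le> N + M \<and> (\<lambda>x. f x * g x) = poly p"
    by (intro exI[of _ "p * r"]) auto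
qed

lemma polyfun_cmult: "polyfun N f \<Longrightarrow> polyfun N (\<lambda>x. c * f x)"
  using polyfun_mult[OF polyfun_const[of 0 c], of N f] by simp

lemma polyfun_multc: "polyfun N f \<Longrightarrow> polyfun N (\<lambda>x. f x * c)"
  using polyfun_cmult[of N f c] by (simp only: mult.commute)

lemma polyfun_diff: "polyfun N f \<Longrightarrow> polyfun N g \<Longrightarrow> polyfun N (\<lambda>x. f x - g x)"
  using polyfun_add[of N f "\<lambda>x. (-1) * g x"] polyfun_mult[OF polyfun_const[of 0 "-1"], of N g] by simp

lemma polyfun_sum: "(\<And>i. i \<in> S \<Longrightarrow> polyfun N (f i)) \<Longrightarrow> polyfun N (\<lambda>x. \<Sum>i\<in>S. f i x)"
  by (induction S rule: infinite_finite_induct) (auto intro: polyfun_const polyfun_add)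

lemma polyfun_prod:
  "(\<And>i. i \<in> S \<Longrightarrow> polyfun (Suc 0) (f i)) \<Longrightarrow> polyfun (card S) (\<lambda>x. \<Prod>i\<in>S. f i x)"
proof (induction S rule: infinite_finite_induct)
  case (insert i S)
  then show ?case using polyfun_mult[of "Suc 0" "f i" "card S"] by simp
qed (auto intro: polyfun_const)

lemma polyfun_eq_0:
  assumes "polyfun N f" "finite S" "N < card S" "\<And>x. x \<in> S \<Longrightarrow> f x = 0"
  shows "f x = 0"
proof -
  obtain p where p: "degree p \<le> N" "f = poly p" using assms(1) polyfun_def by blast
  have "p = 0"
  proof (rule ccontr)
    assume "p \<noteq> 0"
    then have "card S \<le> card {x. poly p x = 0}"
      using assms(4) p poly_roots_finite by (intro card_mono) auto
    also have "\<dots> \<le> degree p" using \<open>p \<noteq> 0\<close> by (rule card_poly_roots_bound)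
    finally show False using p assms(3) by simp
  qed
  then show ?thesis using p by simp
qed


section \<open>The domain wall partition function\<close>

lemma divide_mult_minus:
  fixes a b c :: "'a::field"
  assumes "a \<noteq> b"
  shows "c / (a - b) * (b - a) = - c" "(b - a) * (c / (a - b)) = - c"
proof -
  have "c / (a - b) * (b - a) = - (c / (a - b) * (a - b))"
    by (metis minus_diff_eq mult_minus_right)
  then show "c / (a - b) * (b - a) = - c" using assms by simp
  then show "(b - a) * (c / (a - b)) = - c" by (simp only: mult.commute)
qed

text \<open>
  The partition function of the six-vertex model with domain wall boundary conditions, with row
  variables \<open>A\<close> and column variables \<open>v # vs\<close>, expanded along its first column. Keeping the rows as a
  set builds in the symmetry in them. The columns form a list since the symmetry in
  them is a theorem (\<open>dwpf_move_to_front\<close>).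
\<close>
fun dwpf :: "'a::field \<Rightarrow> 'a list \<Rightarrow> 'a set \<Rightarrow> 'a" where
  "dwpf q [] A = 1"
| "dwpf q (v # vs) A =
    (\<Sum>a\<in>A. (1 - q) * a * (\<Prod>t\<in>set vs. a - q * t)
       * (\<Prod>b\<in>A - {a}. (q * a - b) / (a - b) * (b - v)) * dwpf q vs (A - {a}))"

text \<open>
  Pairing \<open>h a b\<close> with \<open>h b a\<close> has to be done explicitly: in characteristic 2 one cannot
  conclude from the sum being its own negative.
\<close>
lemma antisymmetric_sum:
  fixes h :: "'b \<Rightarrow> 'b \<Rightarrow> 'a::ab_group_add"
  assumes "finite A" "\<And>a b. a \<in> A \<Longrightarrow> b \<in> A \<Longrightarrow> a \<noteq> b \<Longrightarrow> h a b = - h b a"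
  shows "(\<Sum>a\<in>A. \<Sum>b\<in>A - {a}. h a b) = 0"
  using assms
proof (induction A)
  case (insert c A)
  have "(\<Sum>b\<in>insert c A - {a}. h a b) = h a c + (\<Sum>b\<in>A - {a}. h a b)" if "a \<in> A" for a
  proof -
    have "insert c A - {a} = insert c (A - {a})" using that insert.hyps by auto
    then show ?thesis using insert.hyps by simp
  qed
  then have "(\<Sum>a\<in>insert c A. \<Sum>b\<in>insert c A - {a}. h a b)
      = (\<Sum>b\<in>A. h c b) + (\<Sum>a\<in>A. h a c + (\<Sum>b\<in>A - {a}. h a b))"
    using insert.hyps by simp
  also have "\<dots> = (\<Sum>a\<in>A. h c a + h a c) + (\<Sum>a\<in>A. \<Sum>b\<in>A - {a}. h a b)"
    by (simp add: sum.distrib add.assoc)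
  also have "(\<Sum>a\<in>A. h c a + h a c) = 0"
  proof (intro sum.neutral ballI)
    fix a assume "a \<in> A"
    then have "h c a = - h a c" using insert.hyps by (intro insert.prems) auto
    then show "h c a + h a c = 0" by simp
  qed
  also have "(\<Sum>a\<in>A. \<Sum>b\<in>A - {a}. h a b) = 0"
    by (intro insert.IH insert.prems) auto
  finally show ?case by simp
qed simp

lemma dwpf_Cons_Cons:
  assumes "v2 \<notin> set vs" "finite A"
  shows "dwpf q (v1 # v2 # vs) A = (\<Sum>a\<in>A. \<Sum>b\<in>A - {a}.
      (1 - q) * a * ((1 - q) * b) * (\<Prod>t\<in>set vs. (a - q * t) * (b - q * t))
      * (\<Prod>c\<in>A - {a, b}. (q * a - c) / (a - c) * ((q * b - c) / (b - c)) * ((c - v1) * (c - v2)))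
      * dwpf q vs (A - {a, b}) * ((a - q * v2) * ((q * a - b) / (a - b)) * (b - v1)))"
proof -
  have *: "(\<Prod>c\<in>A - {a}. f c) = f b * (\<Prod>c\<in>A - {a, b}. f c)" "A - {a} - {b} = A - {a, b}"
    if "a \<in> A" "b \<in> A - {a}" for a b and f :: "'a \<Rightarrow> 'a"
  proof -
    show "A - {a} - {b} = A - {a, b}" by auto
    then show "(\<Prod>c\<in>A - {a}. f c) = f b * (\<Prod>c\<in>A - {a, b}. f c)"
      using that assms prod.remove[of "A - {a}" b f] by simp
  qed
  show ?thesis
    unfolding dwpf.simps sum_distrib_left
  proof (intro sum.cong refl, goal_cases)
    case (1 a b)
    have "(\<Prod>t\<in>set (v2 # vs). a - q * t) = (a - q * v2) * (\<Prod>t\<in>set vs. a - q * t)"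
      using assms(1) by simp
    then show ?case
      unfolding *(1)[OF 1, of "\<lambda>c. (q * a - c) / (a - c) * (c - v1)"] *(2)[OF 1]
      by (simp only: prod.distrib mult_ac)
  qed
qed

text \<open>
  The summands for \<open>(a, b)\<close> and \<open>(b, a)\<close> share a factor symmetric in both the rows and the two
  columns. What remains is the case of two rows and two columns, where exchanging the columns
  changes the summand by an expression antisymmetric in \<open>a\<close> and \<open>b\<close> (\<open>L_diff\<close>).
\<close>
lemma dwpf_swap:
  assumes "v1 \<notin> set vs" "v2 \<notin> set vs" "finite A"
  shows "dwpf q (v1 # v2 # vs) A = dwpf q (v2 # v1 # vs) A"
proof -
  define K where "K = (\<lambda>v1 v2 a b. (1 - q) * a * ((1 - q) * b) * (\<Prod>t\<in>set vs. (a - q * t) * (b - q * t))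
      * (\<Prod>c\<in>A - {a, b}. (q * a - c) / (a - c) * ((q * b - c) / (b - c)) * ((c - v1) * (c - v2)))
      * dwpf q vs (A - {a, b}))"
  define L where "L = (\<lambda>v1 v2 a b. (a - q * v2) * ((q * a - b) / (a - b)) * (b - v1))"
  have K_sym: "K v1 v2 a b = K v1 v2 b a" "K v1 v2 a b = K v2 v1 a b" for v1 v2 a b
    by (simp_all add: K_def insert_commute mult_ac)
  have L_diff: "L v1 v2 a b - L v2 v1 a b = (v2 - v1) * ((a - q * b) * (q * a - b) / (a - b))" for a b
  proof -
    have "(a - q * v2) * f * (b - v1) - (a - q * v1) * f * (b - v2) = (v2 - v1) * ((a - q * b) * f)" for f
      by (simp add: algebra_simps)
    from this[of "(q * a - b) / (a - b)"] show ?thesis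
      unfolding L_def by (simp only: times_divide_eq_right)
  qed
  have L_antisym: "L v1 v2 a b - L v2 v1 a b = - (L v1 v2 b a - L v2 v1 b a)" if "a \<noteq> b" for a b
  proof -
    have "(b - q * a) * (q * b - a) = (a - q * b) * (q * a - b)" by (simp add: algebra_simps)
    then have "(b - q * a) * (q * b - a) / (b - a) = - ((a - q * b) * (q * a - b) / (a - b))"
      by (metis minus_diff_eq minus_divide_right)
    then show ?thesis unfolding L_diff by simp
  qed
  have "dwpf q (v1 # v2 # vs) A - dwpf q (v2 # v1 # vs) A
      = (\<Sum>a\<in>A. \<Sum>b\<in>A - {a}. K v1 v2 a b * L v1 v2 a b - K v2 v1 a b * L v2 v1 a b)"
    unfolding dwpf_Cons_Cons[OF assms(2,3)] dwpf_Cons_Cons[OF assms(1,3)] K_def L_def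
    by (simp only: sum_subtractf)
  also have "\<dots> = (\<Sum>a\<in>A. \<Sum>b\<in>A - {a}. K v1 v2 a b * (L v1 v2 a b - L v2 v1 a b))"
    using K_sym(2) by (simp add: right_diff_distrib)
  also have "\<dots> = 0"
  proof (rule antisymmetric_sum[OF assms(3)])
    fix a b :: 'a assume "a \<noteq> b"
    then show "K v1 v2 a b * (L v1 v2 a b - L v2 v1 a b)
        = - (K v1 v2 b a * (L v1 v2 b a - L v2 v1 b a))"
      using L_antisym K_sym(1) by (metis mult_minus_right)
  qed
  finally show ?thesis by simp
qed

lemma dwpf_move_to_front:
  assumes "distinct vs" "l \<in> set vs" "finite A"
  shows "dwpf q vs A = dwpf q (l # remove1 l vs) A"
  using assms
proof (induction vs arbitrary: A)
  case (Cons v r)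
  show ?case
  proof (cases "v = l")
    case False
    then have l: "l \<in> set r" using Cons.prems by simp
    have set: "set (l # remove1 l r) = set r" using l Cons.prems by auto
    have "dwpf q (v # r) A = dwpf q (v # l # remove1 l r) A"
      unfolding dwpf.simps(2)[of q v] set using Cons.prems l
      by (intro sum.cong refl arg_cong2[where f = "(*)"] Cons.IH) auto
    also have "\<dots> = dwpf q (l # v # remove1 l r) A"
      using Cons.prems by (intro dwpf_swap) auto
    finally show ?thesis using False by simp
  qed simp
qed simp

lemma dwpf_Cons_insert:
  assumes "finite A" "x \<notin> A"
  shows "dwpf q (v # r) (insert x A)
    = (1 - q) * x * (\<Prod>t\<in>set r. x - q * t) * (\<Prod>b\<in>A. (q * x - b) / (x - b) * (b - v)) * dwpf q r A
    + (\<Sum>l\<in>A. (1 - q) * l * (\<Prod>t\<in>set r. l - q * t) * ((q * l - x) / (l - x) * (x - v))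
        * (\<Prod>b\<in>A - {l}. (q * l - b) / (l - b) * (b - v)) * dwpf q r (insert x (A - {l})))"
proof -
  have "insert x A - {l} = insert x (A - {l})" if "l \<in> A" for l using that assms by auto
  then show ?thesis using assms by (simp add: mult.assoc)
qed

text \<open>
  The Lagrange interpolation polynomial of degree \<open>card A\<close> through the column variables for
  \<open>dwpf q vs (insert x A) / x\<close> as a function of the row variable \<open>x\<close>. At the same time it is
  the expansion of the partition function along the row \<open>x\<close>.
\<close>
definition row_poly :: "'a::field \<Rightarrow> 'a list \<Rightarrow> 'a set \<Rightarrow> 'a \<Rightarrow> 'a" where
  "row_poly q vs A x = (1 - q) * (\<Sum>l\<in>set vs. (\<Prod>b\<in>A. b - q * l)
     * (\<Prod>j\<in>set vs - {l}. (x - j) * ((q * j - l) / (j - l))) * dwpf q (remove1 l vs) A)"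

lemma polyfun_row_poly:
  assumes "distinct vs" "length vs = Suc c"
  shows "polyfun c (row_poly q vs A)"
proof -
  have "polyfun c (\<lambda>x. \<Prod>j\<in>set vs - {l}. (x - j) * ((q * j - l) / (j - l)))" if "l \<in> set vs" for l
  proof -
    have "card (set vs - {l}) = c" using assms that distinct_card by fastforce
    moreover have "polyfun (Suc 0) (\<lambda>x. (x - j) * ((q * j - l) / (j - l)))" for j
      by (intro polyfun_multc polyfun_linears)
    ultimately show ?thesis
      using polyfun_prod[of "set vs - {l}" "\<lambda>j x. (x - j) * ((q * j - l) / (j - l))"] by simp
  qed
  note * = this
  show ?thesis
    unfolding row_poly_def
    by (intro polyfun_cmult polyfun_sum polyfun_multc *)
qed

text \<open>
  Put the column \<open>t\<close> first: in the defining sum every row other than \<open>t\<close> then meets the factor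
  \<open>b - t\<close> with \<open>b = t\<close>, so that one term survives.
\<close>
lemma dwpf_row_at_column:
  assumes "distinct vs" "finite A" "A \<inter> set vs = {}" "t \<in> set vs"
  shows "dwpf q vs (insert t A) = (1 - q) * t * (\<Prod>s\<in>set vs - {t}. t - q * s)
      * (\<Prod>b\<in>A. b - q * t) * dwpf q (remove1 t vs) A"
proof -
  have t: "t \<notin> A" using assms by auto
  have set: "set (remove1 t vs) = set vs - {t}" using assms by simp
  have "dwpf q vs (insert t A) = dwpf q (t # remove1 t vs) (insert t A)"
    using assms by (intro dwpf_move_to_front) auto
  also have "\<dots> = (1 - q) * t * (\<Prod>s\<in>set vs - {t}. t - q * s)
      * (\<Prod>b\<in>A. (q * t - b) / (t - b) * (b - t)) * dwpf q (remove1 t vs) A"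
    unfolding dwpf_Cons_insert[OF assms(2) t] set by simp
  also have "(\<Prod>b\<in>A. (q * t - b) / (t - b) * (b - t)) = (\<Prod>b\<in>A. b - q * t)"
    using t by (intro prod.cong refl, subst divide_mult_minus(1)) auto
  finally show ?thesis .
qed

lemma row_poly_at_column:
  assumes "t \<in> set vs"
  shows "row_poly q vs A t = (1 - q) * (\<Prod>s\<in>set vs - {t}. t - q * s)
      * (\<Prod>b\<in>A. b - q * t) * dwpf q (remove1 t vs) A"
proof -
  have "(\<Sum>l\<in>set vs - {t}. (\<Prod>b\<in>A. b - q * l)
     * (\<Prod>j\<in>set vs - {l}. (t - j) * ((q * j - l) / (j - l))) * dwpf q (remove1 l vs) A) = 0"
  proof (rule sum.neutral, rule ballI)
    fix l assume "l \<in> set vs - {t}"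
    then have "(\<Prod>j\<in>set vs - {l}. (t - j) * ((q * j - l) / (j - l))) = 0"
      using assms by (intro prod_zero bexI[of _ t]) auto
    then show "(\<Prod>b\<in>A. b - q * l) * (\<Prod>j\<in>set vs - {l}. (t - j) * ((q * j - l) / (j - l)))
        * dwpf q (remove1 l vs) A = 0" by simp
  qed
  moreover have "(\<Prod>j\<in>set vs - {t}. (t - j) * ((q * j - t) / (j - t))) = (\<Prod>s\<in>set vs - {t}. t - q * s)"
    by (intro prod.cong refl, subst divide_mult_minus(2)) auto
  ultimately show ?thesis
    unfolding row_poly_def sum.remove[OF finite_set assms] by simp
qed

text \<open>
  By induction the partition functions in the sum along the first column are \<open>x\<close> times polynomials, so
  \<open>(\<Prod>b\<in>A. x - b) * dwpf q vs (insert x A)\<close> is \<open>x\<close> times a polynomial \<open>G\<close> of degree at most \<open>2 * card A\<close>.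
  It is compared with the interpolation polynomial at \<open>2 * card A + 1\<close> points: the columns, and the
  rows in \<open>A\<close>, where the two simple poles of the sum cancel and both sides vanish.
\<close>
lemma dwpf_row_expansion:
  assumes "distinct vs" "finite A" "length vs = Suc (card A)" "A \<inter> set vs = {}" "0 \<notin> set vs"
    and "x \<notin> A"
  shows "dwpf q vs (insert x A) = x * row_poly q vs A x"
  using assms
proof (induction vs arbitrary: A x)
  case (Cons v r)
  have IH: "dwpf q r (insert y (A - {l})) = y * row_poly q r (A - {l}) y"
    if "l \<in> A" "y \<notin> A - {l}" for l y
  proof -
    have "card A = Suc (card (A - {l}))"
      using card_Suc_Diff1[OF Cons.prems(2) that(1)] by (rule sym)
    then show ?thesis
      using that Cons.prems by (intro Cons.IH) auto
  qed
  \<comment> \<open>The expansion along the first column, divided by the new row variable and with the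
    denominators \<open>x - b\<close> cleared; the minus sign comes from \<open>(x - l) / (l - x)\<close>.\<close>
  define G where "G = (\<lambda>x. (1 - q) * (\<Prod>t\<in>set r. x - q * t)
        * (\<Prod>b\<in>A. (q * x - b) * (b - v)) * dwpf q r A
      - (\<Sum>l\<in>A. (1 - q) * l * (\<Prod>t\<in>set r. l - q * t) * ((q * l - x) * (x - v))
        * (\<Prod>b\<in>A - {l}. (x - b) * ((q * l - b) / (l - b) * (b - v))) * row_poly q r (A - {l}) x))"
  define D where "D = (\<lambda>x. G x - row_poly q (v # r) A x * (\<Prod>b\<in>A. x - b))"
  have G: "(\<Prod>b\<in>A. y - b) * dwpf q (v # r) (insert y A) = y * G y" if y: "y \<notin> A" for y
  proof -
    have *: "(\<Prod>b\<in>A. y - b) * (f * (\<Prod>b\<in>A. (q * y - b) / (y - b) * (b - v)) * g)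
       = f * (\<Prod>b\<in>A. (q * y - b) * (b - v)) * g" for f g
    proof -
      have "(\<Prod>b\<in>A. (q * y - b) * (b - v)) = (\<Prod>b\<in>A. y - b) * (\<Prod>b\<in>A. (q * y - b) / (y - b) * (b - v))"
        unfolding prod.distrib[symmetric] using y by (intro prod.cong refl) auto
      then show ?thesis by simp
    qed
    have **: "(\<Prod>b\<in>A. y - b) * (f * ((q * l - y) / (l - y) * (y - v)) * (\<Prod>b\<in>A - {l}. g b) * (y * h))
      = - (y * (f * ((q * l - y) * (y - v)) * (\<Prod>b\<in>A - {l}. (y - b) * g b) * h))" if "l \<in> A" for f g h l
    proof -
      have split: "(\<Prod>b\<in>A. y - b) = (y - l) * (\<Prod>b\<in>A - {l}. y - b)"
        using that Cons.prems(2) by (simp add: prod.remove)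
      have cancel: "(y - l) * ((q * l - y) / (l - y)) = - (q * l - y)"
        using that y by (intro divide_mult_minus) auto
      have "(\<Prod>b\<in>A. y - b) * (f * ((q * l - y) / (l - y) * (y - v)) * (\<Prod>b\<in>A - {l}. g b) * (y * h))
        = (y - l) * ((q * l - y) / (l - y))
          * (y * (f * (y - v) * ((\<Prod>b\<in>A - {l}. y - b) * (\<Prod>b\<in>A - {l}. g b)) * h))"
        unfolding split by (simp only: mult_ac)
      then show ?thesis
        unfolding cancel prod.distrib by (simp only: mult_ac mult_minus_left mult_minus_right)
    qed
    have "(\<Prod>b\<in>A. y - b) * dwpf q (v # r) (insert y A)
      = y * ((1 - q) * (\<Prod>t\<in>set r. y - q * t) * (\<Prod>b\<in>A. (q * y - b) * (b - v)) * dwpf q r A)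
      + (\<Sum>l\<in>A. - (y * ((1 - q) * l * (\<Prod>t\<in>set r. l - q * t) * ((q * l - y) * (y - v))
        * (\<Prod>b\<in>A - {l}. (y - b) * ((q * l - b) / (l - b) * (b - v))) * row_poly q r (A - {l}) y)))"
      unfolding dwpf_Cons_insert[OF Cons.prems(2) y] distrib_left * sum_distrib_left
    proof (intro arg_cong2[where f = "(+)"] sum.cong refl, goal_cases)
      case 1
      show ?case by (simp only: mult_ac)
    next
      case (2 l)
      have "dwpf q r (insert y (A - {l})) = y * row_poly q r (A - {l}) y"
        using y 2 by (intro IH) auto
      then show ?case using **[OF 2] by (simp only: )
    qed
    then show ?thesis
      unfolding G_def by (simp add: right_diff_distrib sum_negf sum_distrib_left)
  qed
  have "D x = 0"
  proof (rule polyfun_eq_0[where f = D])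
    show "polyfun (card A + card A) D"
      unfolding D_def G_def
    proof (intro polyfun_diff polyfun_sum, goal_cases)
      case 1
      have "card (set r) = card A"
        using Cons.prems distinct_card[of r] by simp
      then have "polyfun (card A) (\<lambda>x. \<Prod>t\<in>set r. x - q * t)"
        using polyfun_prod[of "set r" "\<lambda>t x. x - q * t"] polyfun_linears(1) by metis
      moreover have "polyfun (card A) (\<lambda>x. \<Prod>b\<in>A. (q * x - b) * (b - v))"
        by (intro polyfun_prod polyfun_multc polyfun_linears)
      ultimately show ?case
        by (intro polyfun_multc polyfun_mult polyfun_cmult)
    next
      case (2 l)
      have card: "card A = Suc (card (A - {l}))"
        using card_Suc_Diff1[OF Cons.prems(2) 2] by (rule sym)
      have "polyfun (Suc 0 + Suc 0) (\<lambda>x. (q * l - x) * (x - v))"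
        by (intro polyfun_mult polyfun_linears)
      moreover have "polyfun (card (A - {l})) (\<lambda>x. \<Prod>b\<in>A - {l}. (x - b) * ((q * l - b) / (l - b) * (b - v)))"
        by (intro polyfun_prod polyfun_multc polyfun_linears)
      moreover have "polyfun (card (A - {l})) (row_poly q r (A - {l}))"
        using Cons.prems card by (intro polyfun_row_poly) auto
      ultimately have "polyfun (Suc 0 + Suc 0 + card (A - {l}) + card (A - {l}))
        (\<lambda>x. (1 - q) * l * (\<Prod>t\<in>set r. l - q * t) * ((q * l - x) * (x - v))
        * (\<Prod>b\<in>A - {l}. (x - b) * ((q * l - b) / (l - b) * (b - v))) * row_poly q r (A - {l}) x)"
        by (intro polyfun_mult[OF polyfun_mult[OF polyfun_cmult]])
      then show ?case by (rule polyfun_mono) (use card in simp)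
    next
      case 3
      show ?case using Cons.prems
        by (intro polyfun_mult polyfun_row_poly polyfun_prod polyfun_linears) auto
    qed
  next
    show "card A + card A < card (A \<union> set (v # r))"
      using Cons.prems distinct_card[OF Cons.prems(1)] by (simp add: card_Un_disjoint)
  next
    fix y assume y: "y \<in> A \<union> set (v # r)"
    show "D y = 0"
    \<comment> \<open>At a row \<open>y\<close>, of the sum over \<open>l\<close> only \<open>l = y\<close> remains and cancels the first term of \<open>G\<close>.\<close>
    proof (cases "y \<in> A")
      case True
      have fin: "finite A" by fact
      have *: "(\<Prod>b\<in>A - {l}. (y - b) * g b) = 0" if "l \<in> A - {y}" for g l
        using that True fin by (intro prod_zero bexI[of _ y]) auto
      have "(\<Prod>b\<in>A. y - b) = 0"
        using True fin by (intro prod_zero) auto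
      moreover have "G y = 0"
      proof -
        have "(\<Sum>l\<in>A. (1 - q) * l * (\<Prod>t\<in>set r. l - q * t) * ((q * l - y) * (y - v))
          * (\<Prod>b\<in>A - {l}. (y - b) * ((q * l - b) / (l - b) * (b - v))) * row_poly q r (A - {l}) y)
          = (1 - q) * y * (\<Prod>t\<in>set r. y - q * t) * ((q * y - y) * (y - v))
          * (\<Prod>b\<in>A - {y}. (y - b) * ((q * y - b) / (y - b) * (b - v))) * row_poly q r (A - {y}) y"
          unfolding sum.remove[OF fin True] using *
          by (simp del: times_divide_eq_left times_divide_eq_right)
        also have "(\<Prod>b\<in>A - {y}. (y - b) * ((q * y - b) / (y - b) * (b - v)))
            = (\<Prod>b\<in>A - {y}. (q * y - b) * (b - v))"
          by (intro prod.cong) auto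
        finally show ?thesis
          unfolding G_def using IH[OF True, of y] True
          by (simp add: insert_absorb prod.remove[OF fin True] mult_ac)
      qed
      ultimately show ?thesis by (simp add: D_def)
    next
      case False
      then have y: "y \<in> set (v # r)" using y by auto
      have "y * G y = (\<Prod>b\<in>A. y - b) * (y * row_poly q (v # r) A y)"
        using G[OF False] dwpf_row_at_column[OF Cons.prems(1,2,4) y] row_poly_at_column[OF y, of q A]
        by (simp only: mult_ac)
      then have "y * D y = 0" by (simp add: D_def algebra_simps)
      then show ?thesis using y Cons.prems by auto
    qed
  qed (use Cons.prems in auto)
  then have "(\<Prod>b\<in>A. x - b) * dwpf q (v # r) (insert x A)
      = (\<Prod>b\<in>A. x - b) * (x * row_poly q (v # r) A x)"
    using G[OF Cons.prems(6)] by (simp add: D_def)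
  moreover have "(\<Prod>b\<in>A. x - b) \<noteq> 0"
    using Cons.prems by auto
  ultimately show ?case by simp
qed simp

text \<open>
  In terms of the six-vertex model, this moves a row \<open>x\<close> through the rows \<open>A\<close>: either \<open>x\<close> leaves the set of
  rows unchanged, or it takes the place of some \<open>a \<in> A\<close>. At \<open>x = t\<close> for a column \<open>t\<close>, the
  identity becomes the expansion of \<open>dwpf q vs A\<close> along the column \<open>t\<close>.
\<close>
lemma dwpf_eliminate_row:
  assumes "distinct vs" "finite A" "length vs = card A" "A \<inter> set vs = {}"
    and "0 \<notin> set vs" "0 \<notin> A" and "x \<notin> A"
  shows "(\<Prod>t\<in>set vs. x - q * t) * (\<Prod>a\<in>A. (q * x - a) / (x - a)) * dwpf q vs A
    = q ^ length vs * (\<Prod>t\<in>set vs. x - t) * dwpf q vs A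
    + (\<Sum>a\<in>A. (1 - q) * a / (a - x) * (\<Prod>t\<in>set vs. a - q * t)
        * (\<Prod>b\<in>A - {a}. (q * a - b) / (a - b)) * dwpf q vs (insert x (A - {a})))"
proof -
  define R where "R = (\<lambda>a. row_poly q vs (A - {a}))"
  have card_A: "card A = Suc (card (A - {a}))" if "a \<in> A" for a
    using card_Suc_Diff1[OF assms(2) that] by (rule sym)
  have R: "dwpf q vs (insert y (A - {a})) = y * R a y" if "a \<in> A" "y \<notin> A - {a}" for a y
    unfolding R_def
    by (rule dwpf_row_expansion[OF assms(1) _ trans[OF assms(3) card_A[OF that(1)]] _ assms(5) that(2)])
      (use assms in auto)
  have card_vs: "card (set vs) = card A" using assms distinct_card by metis
  \<comment> \<open>The two sides with denominators cleared, where \<open>x * R a x\<close> stands for the partition function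
    with \<open>x\<close> in place of \<open>a\<close>, so that its value at \<open>x = a\<close> makes sense.\<close>
  define D where "D = (\<lambda>x. (\<Prod>t\<in>set vs. x - q * t) * (\<Prod>a\<in>A. q * x - a) * dwpf q vs A
    - (\<Prod>t\<in>set vs. q * (x - t)) * (\<Prod>a\<in>A. x - a) * dwpf q vs A
    + (\<Sum>a\<in>A. (1 - q) * a * (\<Prod>t\<in>set vs. a - q * t)
        * (\<Prod>b\<in>A - {a}. (q * a - b) / (a - b) * (x - b)) * x * R a x))"
  have D: "D y = (\<Prod>a\<in>A. y - a) * ((\<Prod>t\<in>set vs. y - q * t) * (\<Prod>a\<in>A. (q * y - a) / (y - a)) * dwpf q vs A
    - q ^ length vs * (\<Prod>t\<in>set vs. y - t) * dwpf q vs A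
    - (\<Sum>a\<in>A. (1 - q) * a / (a - y) * (\<Prod>t\<in>set vs. a - q * t)
        * (\<Prod>b\<in>A - {a}. (q * a - b) / (a - b)) * dwpf q vs (insert y (A - {a}))))"
    if y: "y \<notin> A" for y
  proof -
    have "(\<Prod>a\<in>A. q * y - a) = (\<Prod>a\<in>A. y - a) * (\<Prod>a\<in>A. (q * y - a) / (y - a))"
      unfolding prod.distrib[symmetric] using y by (intro prod.cong refl) auto
    moreover have "(\<Prod>t\<in>set vs. q * (y - t)) = q ^ length vs * (\<Prod>t\<in>set vs. y - t)"
      using distinct_card[OF assms(1)] by (simp add: prod.distrib)
    moreover have "(1 - q) * a * (\<Prod>t\<in>set vs. a - q * t)
        * (\<Prod>b\<in>A - {a}. (q * a - b) / (a - b) * (y - b)) * y * R a y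
      = - ((\<Prod>a\<in>A. y - a) * ((1 - q) * a / (a - y) * (\<Prod>t\<in>set vs. a - q * t)
        * (\<Prod>b\<in>A - {a}. (q * a - b) / (a - b)) * dwpf q vs (insert y (A - {a}))))"
      if "a \<in> A" for a
    proof -
      have split: "(\<Prod>a\<in>A. y - a) = (y - a) * (\<Prod>b\<in>A - {a}. y - b)"
        using that assms(2) by (simp add: prod.remove)
      have row: "dwpf q vs (insert y (A - {a})) = y * R a y"
        using y by (intro R that) auto
      have cancel: "(y - a) * ((1 - q) * a / (a - y)) = - ((1 - q) * a)"
        using that y by (intro divide_mult_minus) auto
      have "(\<Prod>a\<in>A. y - a) * ((1 - q) * a / (a - y) * (\<Prod>t\<in>set vs. a - q * t)
        * (\<Prod>b\<in>A - {a}. (q * a - b) / (a - b)) * dwpf q vs (insert y (A - {a})))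
        = (y - a) * ((1 - q) * a / (a - y)) * ((\<Prod>t\<in>set vs. a - q * t)
        * ((\<Prod>b\<in>A - {a}. (q * a - b) / (a - b)) * (\<Prod>b\<in>A - {a}. y - b)) * (y * R a y))"
        unfolding split row by (simp only: mult_ac)
      then show ?thesis
        unfolding cancel prod.distrib by (simp only: mult_ac mult_minus_left mult_minus_right minus_minus)
    qed
    ultimately show ?thesis
      unfolding D_def right_diff_distrib sum_distrib_left
      by (simp add: sum_negf mult.assoc del: times_divide_eq_left times_divide_eq_right)
  qed
  have "D x = 0"
  proof (rule polyfun_eq_0[where f = D])
    show "polyfun (card A + card A) D"
      unfolding D_def
    proof (intro polyfun_diff polyfun_add polyfun_sum, goal_cases)
      case 1
      have "polyfun (card A) (\<lambda>x. \<Prod>t\<in>set vs. x - q * t)"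
        using polyfun_prod[of "set vs" "\<lambda>t x. x - q * t"] polyfun_linears(1) card_vs by metis
      then show ?case
        by (intro polyfun_multc polyfun_mult polyfun_prod polyfun_linears)
    next
      case 2
      have "polyfun (card (set vs)) (\<lambda>x. \<Prod>t\<in>set vs. q * (x - t))"
        by (intro polyfun_prod polyfun_cmult polyfun_linears)
      then show ?case
        unfolding card_vs by (intro polyfun_multc polyfun_mult polyfun_prod polyfun_linears)
    next
      case (3 a)
      have "polyfun (card (A - {a})) (\<lambda>x. \<Prod>b\<in>A - {a}. (q * a - b) / (a - b) * (x - b))"
        by (intro polyfun_prod polyfun_cmult polyfun_linears)
      moreover have "polyfun (Suc 0) (\<lambda>x. x)"
        using polyfun_linears(1)[of 0] by simp
      moreover have "polyfun (card (A - {a})) (R a)"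
        unfolding R_def by (rule polyfun_row_poly[OF assms(1) trans[OF assms(3) card_A[OF 3]]])
      ultimately have "polyfun (card (A - {a}) + Suc 0 + card (A - {a}))
        (\<lambda>x. (1 - q) * a * (\<Prod>t\<in>set vs. a - q * t)
        * (\<Prod>b\<in>A - {a}. (q * a - b) / (a - b) * (x - b)) * x * R a x)"
        by (intro polyfun_mult[OF polyfun_mult[OF polyfun_cmult]])
      then show ?case by (rule polyfun_mono) (use card_A[OF 3] in simp)
    qed
  next
    show "card A + card A < card (insert 0 (A \<union> set vs))"
      using assms card_vs by (simp add: card_Un_disjoint)
  next
    fix y assume y: "y \<in> insert 0 (A \<union> set vs)"
    show "D y = 0"
    proof (cases "y \<in> A")
      case True
      have *: "(\<Prod>b\<in>A - {a}. (q * a - b) / (a - b) * (y - b)) = 0" if "a \<in> A - {y}" for a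
        using that True assms(2) by (intro prod_zero bexI[of _ y]) auto
      have "(\<Prod>a\<in>A. y - a) = 0"
        using True assms(2) by (intro prod_zero) auto
      moreover have "(\<Sum>a\<in>A. (1 - q) * a * (\<Prod>t\<in>set vs. a - q * t)
        * (\<Prod>b\<in>A - {a}. (q * a - b) / (a - b) * (y - b)) * y * R a y)
        = - ((\<Prod>t\<in>set vs. y - q * t) * (\<Prod>a\<in>A. q * y - a) * dwpf q vs A)"
      proof -
        have "(\<Sum>a\<in>A. (1 - q) * a * (\<Prod>t\<in>set vs. a - q * t)
          * (\<Prod>b\<in>A - {a}. (q * a - b) / (a - b) * (y - b)) * y * R a y)
          = (1 - q) * y * (\<Prod>t\<in>set vs. y - q * t)
          * (\<Prod>b\<in>A - {y}. (q * y - b) / (y - b) * (y - b)) * y * R y y"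
          unfolding sum.remove[OF assms(2) True] using *
          by (simp del: times_divide_eq_left times_divide_eq_right)
        also have "(\<Prod>b\<in>A - {y}. (q * y - b) / (y - b) * (y - b)) = (\<Prod>b\<in>A - {y}. q * y - b)"
          by (intro prod.cong) auto
        also have "(1 - q) * y * (\<Prod>t\<in>set vs. y - q * t) * \<dots> * y * R y y
          = (1 - q) * y * (\<Prod>t\<in>set vs. y - q * t) * (\<Prod>b\<in>A - {y}. q * y - b) * dwpf q vs A"
          using R[OF True, of y] True by (simp add: insert_absorb)
        also have "\<dots> = - ((\<Prod>t\<in>set vs. y - q * t) * (\<Prod>a\<in>A. q * y - a) * dwpf q vs A)"
          unfolding prod.remove[OF assms(2) True] by (simp add: algebra_simps)
        finally show ?thesis .
      qed
      ultimately show ?thesis by (simp add: D_def)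
    next
      case y_notin: False
      show ?thesis
      proof (cases "y = 0")
        case True
        have "(\<Prod>t\<in>set vs. - (q * t)) * (\<Prod>a\<in>A. - a) = (\<Prod>t\<in>set vs. q * (0 - t)) * (\<Prod>a\<in>A. 0 - a)"
          by simp
        then show ?thesis by (simp add: D_def True)
      next
        case False
        then have y: "y \<in> set vs" using y y_notin by auto
        have "dwpf q vs A = dwpf q (y # remove1 y vs) A"
          by (rule dwpf_move_to_front[OF assms(1) y assms(2)])
        also have "\<dots> = (\<Sum>a\<in>A. (1 - q) * a * (\<Prod>t\<in>set vs - {y}. a - q * t)
          * (\<Prod>b\<in>A - {a}. (q * a - b) / (a - b) * (b - y)) * dwpf q (remove1 y vs) (A - {a}))"
          using assms(1) by simp
        finally have front: "dwpf q vs A = \<dots>" .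
        have "(\<Prod>t\<in>set vs. y - q * t) * (\<Prod>a\<in>A. (q * y - a) / (y - a)) * dwpf q vs A
          = (\<Sum>a\<in>A. (1 - q) * a / (a - y) * (\<Prod>t\<in>set vs. a - q * t)
            * (\<Prod>b\<in>A - {a}. (q * a - b) / (a - b)) * dwpf q vs (insert y (A - {a})))"
          unfolding front sum_distrib_left
        proof (intro sum.cong refl)
          fix a assume a: "a \<in> A"
          have row: "dwpf q vs (insert y (A - {a})) = (1 - q) * y * (\<Prod>t\<in>set vs - {y}. y - q * t)
              * (\<Prod>b\<in>A - {a}. b - q * y) * dwpf q (remove1 y vs) (A - {a})"
            using assms a y by (intro dwpf_row_at_column) auto
          have split: "(\<Prod>t\<in>set vs. c - q * t) = (c - q * y) * (\<Prod>t\<in>set vs - {y}. c - q * t)" for c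
            by (rule prod.remove[OF finite_set y])
          have split_phi: "(\<Prod>c\<in>A. (q * y - c) / (y - c))
              = (a - q * y) / (a - y) * (\<Prod>c\<in>A - {a}. (q * y - c) / (y - c))"
            unfolding prod.remove[OF assms(2) a] minus_divide_divide[of "a - q * y" "a - y", symmetric]
            by simp
          have cancel: "(\<Prod>b\<in>A - {a}. b - q * y)
              = (\<Prod>b\<in>A - {a}. (q * y - b) / (y - b)) * (\<Prod>b\<in>A - {a}. b - y)"
            unfolding prod.distrib[symmetric] using y_notin
            by (intro prod.cong refl, subst divide_mult_minus(1)) auto
          have at_y: "y - q * y = (1 - q) * y" by (simp add: algebra_simps)
          show "(\<Prod>t\<in>set vs. y - q * t) * (\<Prod>a\<in>A. (q * y - a) / (y - a))
            * ((1 - q) * a * (\<Prod>t\<in>set vs - {y}. a - q * t)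
              * (\<Prod>b\<in>A - {a}. (q * a - b) / (a - b) * (b - y)) * dwpf q (remove1 y vs) (A - {a}))
            = (1 - q) * a / (a - y) * (\<Prod>t\<in>set vs. a - q * t)
            * (\<Prod>b\<in>A - {a}. (q * a - b) / (a - b)) * dwpf q vs (insert y (A - {a}))"
            unfolding row split[of y] split[of a] split_phi cancel at_y
            by (simp only: prod.distrib divide_inverse mult_ac)
        qed
        moreover have "(\<Prod>t\<in>set vs. y - t) = 0"
          using y by (intro prod_zero) auto
        ultimately show ?thesis unfolding D[OF y_notin] by simp
      qed
    qed
  qed (use assms in auto)
  then show ?thesis
    unfolding D[OF assms(7)] using assms(2,7) by (auto simp: diff_eq_eq)
qed


section \<open>Symmetrizations over a finite set\<close>

text \<open>
  For \<open>length gs = card A\<close>, the sum over all bijections \<open>a\<close> from the positions of \<open>gs\<close> to \<open>A\<close> of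
  \<open>\<Prod>j. gs ! j (a j)\<close> times the product of \<open>\<phi> (a i) (a j)\<close> over \<open>i < j\<close>, organized by the choice
  of the first value. \<open>F\<close>, \<open>Fbar\<close> and \<open>dwpf\<close> are all of this form.
\<close>
fun symmetrization :: "('i \<Rightarrow> 'i \<Rightarrow> 'a::comm_ring_1) \<Rightarrow> ('i \<Rightarrow> 'a) list \<Rightarrow> 'i set \<Rightarrow> 'a" where
  "symmetrization \<phi> [] A = 1"
| "symmetrization \<phi> (g # gs) A =
    (\<Sum>a\<in>A. g a * (\<Prod>b\<in>A - {a}. \<phi> a b) * symmetrization \<phi> gs (A - {a}))"

lemma symmetrization_cong:
  assumes "\<And>a b. a \<in> A \<Longrightarrow> b \<in> A \<Longrightarrow> a \<noteq> b \<Longrightarrow> \<phi> a b = \<phi>' a b"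
    and "\<And>j a. j \<in> set js \<Longrightarrow> a \<in> A \<Longrightarrow> g j a = g' j a"
  shows "symmetrization \<phi> (map g js) A = symmetrization \<phi>' (map g' js) A"
  using assms
proof (induction js arbitrary: A)
  case (Cons j js)
  have "symmetrization \<phi> (map g js) (A - {a}) = symmetrization \<phi>' (map g' js) (A - {a})" for a
    by (intro Cons.IH Cons.prems) auto
  then show ?case
    using Cons.prems by (auto intro!: sum.cong prod.cong arg_cong2[where f = "(*)"])
qed simp

lemma symmetrization_image:
  assumes "inj_on e A"
  shows "symmetrization \<phi> gs (e ` A) = symmetrization (\<lambda>i j. \<phi> (e i) (e j)) (map (\<lambda>g. g \<circ> e) gs) A"
  using assms
proof (induction gs arbitrary: A)
  case (Cons g gs)
  have "symmetrization \<phi> (g # gs) (e ` A)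
      = (\<Sum>a\<in>A. g (e a) * (\<Prod>b\<in>e ` A - {e a}. \<phi> (e a) b) * symmetrization \<phi> gs (e ` A - {e a}))"
    using Cons.prems by (simp add: sum.reindex)
  also have "\<dots> = (\<Sum>a\<in>A. g (e a) * (\<Prod>b\<in>A - {a}. \<phi> (e a) (e b))
      * symmetrization (\<lambda>i j. \<phi> (e i) (e j)) (map (\<lambda>g. g \<circ> e) gs) (A - {a}))"
  proof (intro sum.cong refl)
    fix a assume a: "a \<in> A"
    then have image: "e ` A - {e a} = e ` (A - {a})"
      using Cons.prems by (auto simp: inj_on_def)
    have inj: "inj_on e (A - {a})" using Cons.prems by (auto intro: inj_on_diff)
    show "g (e a) * (\<Prod>b\<in>e ` A - {e a}. \<phi> (e a) b) * symmetrization \<phi> gs (e ` A - {e a})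
      = g (e a) * (\<Prod>b\<in>A - {a}. \<phi> (e a) (e b))
      * symmetrization (\<lambda>i j. \<phi> (e i) (e j)) (map (\<lambda>g. g \<circ> e) gs) (A - {a})"
      unfolding image Cons.IH[OF inj] using inj by (simp add: prod.reindex)
  qed
  finally show ?case by (simp add: comp_def)
qed simp

lemma symmetrization_weight:
  assumes "finite A" "length js = card A"
  shows "symmetrization \<phi> (map (\<lambda>j a. c a * g j a) js) A = (\<Prod>a\<in>A. c a) * symmetrization \<phi> (map g js) A"
  using assms
proof (induction js arbitrary: A)
  case (Cons j js)
  show ?case
    unfolding list.map symmetrization.simps sum_distrib_left
  proof (intro sum.cong refl)
    fix a assume a: "a \<in> A"
    then have "length js = card (A - {a})" using Cons.prems by simp
    then have "symmetrization \<phi> (map (\<lambda>j a. c a * g j a) js) (A - {a})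
        = (\<Prod>a\<in>A - {a}. c a) * symmetrization \<phi> (map g js) (A - {a})"
      using Cons.prems by (intro Cons.IH) auto
    moreover have "(\<Prod>a\<in>A. c a) = c a * (\<Prod>a\<in>A - {a}. c a)"
      using a Cons.prems by (intro prod.remove) auto
    ultimately show "c a * g j a * (\<Prod>b\<in>A - {a}. \<phi> a b) * symmetrization \<phi> (map (\<lambda>j a. c a * g j a) js) (A - {a})
      = (\<Prod>a\<in>A. c a) * (g j a * (\<Prod>b\<in>A - {a}. \<phi> a b) * symmetrization \<phi> (map g js) (A - {a}))"
      by (simp only: mult_ac)
  qed
qed simp

lemma sum_subsets_insert:
  assumes "finite A"
  shows "(\<Sum>B | B \<subseteq> A \<and> card B = n. \<Sum>a\<in>A - B. f a B)
    = (\<Sum>B | B \<subseteq> A \<and> card B = Suc n. \<Sum>a\<in>B. f a (B - {a}))"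
proof -
  have fin: "finite {B. B \<subseteq> A \<and> card B = m}" for m
    using assms by simp
  have "(\<Sum>B | B \<subseteq> A \<and> card B = n. \<Sum>a\<in>A - B. f a B)
      = (\<Sum>(B, a)\<in>(SIGMA B:{B. B \<subseteq> A \<and> card B = n}. A - B). f a B)"
    using assms fin by (intro sum.Sigma) auto
  also have "\<dots> = (\<Sum>(B, a)\<in>(SIGMA B:{B. B \<subseteq> A \<and> card B = Suc n}. B). f a (B - {a}))"
  proof (rule sum.reindex_bij_witness[where i = "\<lambda>(B, a). (B - {a}, a)" and j = "\<lambda>(B, a). (insert a B, a)"], goal_cases)
    case (2 z)
    then show ?case using finite_subset[OF _ assms] by (auto simp: card_insert_if)
  next
    case (4 z)
    then show ?case using finite_subset[OF _ assms] by (auto simp: card_Diff_singleton)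
  qed auto
  also have "\<dots> = (\<Sum>B | B \<subseteq> A \<and> card B = Suc n. \<Sum>a\<in>B. f a (B - {a}))"
    using fin finite_subset[OF _ assms] by (intro sum.Sigma[symmetric]) auto
  finally show ?thesis .
qed

lemma symmetrization_append:
  assumes "finite A"
  shows "symmetrization \<phi> (gs @ hs) A = (\<Sum>B | B \<subseteq> A \<and> card B = length gs.
    symmetrization \<phi> gs B * (\<Prod>b\<in>B. \<Prod>c\<in>A - B. \<phi> b c) * symmetrization \<phi> hs (A - B))"
  using assms
proof (induction gs arbitrary: A)
  case Nil
  have "{B. B \<subseteq> A \<and> card B = 0} = {{}}"
    using Nil finite_subset by fastforce
  then show ?case by simp
next
  case (Cons g gs)
  define f where "f = (\<lambda>a B. g a * (\<Prod>b\<in>A - {a}. \<phi> a b) * (symmetrization \<phi> gs B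
      * (\<Prod>b\<in>B. \<Prod>c\<in>A - {a} - B. \<phi> b c) * symmetrization \<phi> hs (A - {a} - B)))"
  have "symmetrization \<phi> ((g # gs) @ hs) A
      = (\<Sum>a\<in>A. \<Sum>B | B \<subseteq> A - {a} \<and> card B = length gs. f a B)"
    using Cons by (simp add: f_def sum_distrib_left)
  also have "\<dots> = (\<Sum>a\<in>A. \<Sum>B | B \<in> {B. B \<subseteq> A \<and> card B = length gs} \<and> a \<in> A - B. f a B)"
    by (intro sum.cong) auto
  also have "\<dots> = (\<Sum>B | B \<subseteq> A \<and> card B = length gs. \<Sum>a | a \<in> A \<and> a \<in> A - B. f a B)"
    using Cons.prems by (intro sum.swap_restrict) auto
  also have "\<dots> = (\<Sum>B | B \<subseteq> A \<and> card B = length gs. \<Sum>a\<in>A - B. f a B)"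
    by (intro sum.cong) auto
  also have "\<dots> = (\<Sum>B | B \<subseteq> A \<and> card B = Suc (length gs). \<Sum>a\<in>B. f a (B - {a}))"
    by (rule sum_subsets_insert[OF Cons.prems])
  also have "\<dots> = (\<Sum>B | B \<subseteq> A \<and> card B = Suc (length gs).
      symmetrization \<phi> (g # gs) B * (\<Prod>b\<in>B. \<Prod>c\<in>A - B. \<phi> b c) * symmetrization \<phi> hs (A - B))"
    unfolding symmetrization.simps sum_distrib_right
  proof (intro sum.cong refl, goal_cases)
    case (1 B a)
    then have B: "finite B" "B \<subseteq> A" "a \<in> B"
      using finite_subset[OF _ Cons.prems] by auto
    then have diff: "A - {a} - (B - {a}) = A - B" by auto
    have "A - {a} = (B - {a}) \<union> (A - B)" using B by auto
    then have "(\<Prod>b\<in>A - {a}. \<phi> a b) = (\<Prod>b\<in>B - {a}. \<phi> a b) * (\<Prod>b\<in>A - B. \<phi> a b)"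
      using B Cons.prems by (simp add: prod.union_disjoint[symmetric] disjoint_iff)
    moreover have "(\<Prod>b\<in>B. \<Prod>c\<in>A - B. \<phi> b c)
        = (\<Prod>c\<in>A - B. \<phi> a c) * (\<Prod>b\<in>B - {a}. \<Prod>c\<in>A - B. \<phi> b c)"
      using B by (intro prod.remove)
    ultimately show ?case
      unfolding f_def diff by (simp only: mult_ac)
  qed
  finally show ?case by (simp only: length_Cons)
qed

lemma symmetrization_snoc:
  assumes "finite A" "card A = Suc (length gs)"
  shows "symmetrization \<phi> (gs @ [h]) A
    = (\<Sum>l\<in>A. symmetrization \<phi> gs (A - {l}) * (\<Prod>b\<in>A - {l}. \<phi> b l) * h l)"
proof -
  have inj: "inj_on (\<lambda>l. A - {l}) A" by (auto simp: inj_on_def)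
  have image: "{B. B \<subseteq> A \<and> card B = length gs} = (\<lambda>l. A - {l}) ` A"
  proof (intro equalityI subsetI)
    fix B assume B: "B \<in> {B. B \<subseteq> A \<and> card B = length gs}"
    then have "card (A - B) = 1"
      using assms finite_subset[of B A] by (simp add: card_Diff_subset)
    then obtain l where "A - B = {l}" by (auto simp: card_1_singleton_iff)
    then show "B \<in> (\<lambda>l. A - {l}) ` A" using B by auto
  qed (use assms in auto)
  have "A - (A - {l}) = {l}" if "l \<in> A" for l using that by auto
  then show ?thesis
    unfolding symmetrization_append[OF assms(1)] image sum.reindex[OF inj] by simp
qed

fun ordering_weight :: "('i \<Rightarrow> 'i \<Rightarrow> 'a::comm_ring_1) \<Rightarrow> ('i \<Rightarrow> 'a) list \<Rightarrow> 'i list \<Rightarrow> 'a" where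
  "ordering_weight \<phi> (g # gs) (a # as) = g a * (\<Prod>b\<in>set as. \<phi> a b) * ordering_weight \<phi> gs as"
| "ordering_weight \<phi> _ _ = 1"

lemma symmetrization_eq_sum_orderings:
  assumes "finite A" "length gs = card A"
  shows "symmetrization \<phi> gs A = (\<Sum>as\<in>permutations_of_set A. ordering_weight \<phi> gs as)"
  using assms
proof (induction gs arbitrary: A)
  case (Cons g gs)
  have ne: "A \<noteq> {}" using Cons.prems by auto
  have "(\<Sum>as\<in>permutations_of_set A. ordering_weight \<phi> (g # gs) as)
      = (\<Sum>a\<in>A. \<Sum>as\<in>(#) a ` permutations_of_set (A - {a}). ordering_weight \<phi> (g # gs) as)"
    unfolding permutations_of_set_nonempty[OF ne]
    using Cons.prems by (intro sum.UNION_disjoint) auto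
  also have "\<dots> = (\<Sum>a\<in>A. g a * (\<Prod>b\<in>A - {a}. \<phi> a b) * symmetrization \<phi> gs (A - {a}))"
  proof (intro sum.cong refl)
    fix a assume a: "a \<in> A"
    then have "length gs = card (A - {a})" using Cons.prems by simp
    then have "symmetrization \<phi> gs (A - {a}) = (\<Sum>as\<in>permutations_of_set (A - {a}). ordering_weight \<phi> gs as)"
      using Cons.prems by (intro Cons.IH) auto
    then show "(\<Sum>as\<in>(#) a ` permutations_of_set (A - {a}). ordering_weight \<phi> (g # gs) as)
        = g a * (\<Prod>b\<in>A - {a}. \<phi> a b) * symmetrization \<phi> gs (A - {a})"
      by (simp add: sum.reindex sum_distrib_left permutations_of_setD)
  qed
  finally show ?case by simp
qed simp

lemma ordering_weight_upt:
  assumes "inj_on \<sigma> {s..<t}"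
  shows "ordering_weight \<phi> (map g [s..<t]) (map \<sigma> [s..<t])
    = (\<Prod>j\<in>{s..<t}. g j (\<sigma> j)) * (\<Prod>(i, j)\<in>{(i, j). s \<le> i \<and> i < j \<and> j < t}. \<phi> (\<sigma> i) (\<sigma> j))"
  using assms
proof (induction "t - s" arbitrary: s)
  case 0
  then have empty: "{(i, j). s \<le> i \<and> i < j \<and> j < t} = {}" by auto
  show ?case unfolding empty using 0 by simp
next
  case (Suc m)
  then have st: "s < t" by simp
  have pairs: "{(i, j). s \<le> i \<and> i < j \<and> j < t}
      = {s} \<times> {Suc s..<t} \<union> {(i, j). Suc s \<le> i \<and> i < j \<and> j < t}" by auto
  have fin: "finite {(i, j). Suc s \<le> i \<and> i < j \<and> j < t}"
    by (rule finite_subset[of _ "{..t} \<times> {..t}"]) auto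
  have inj: "inj_on \<sigma> {Suc s..<t}"
    using Suc.prems by (rule inj_on_subset) auto
  have "(\<Prod>(i, j)\<in>{(i, j). s \<le> i \<and> i < j \<and> j < t}. \<phi> (\<sigma> i) (\<sigma> j))
      = (\<Prod>(i, j)\<in>{s} \<times> {Suc s..<t}. \<phi> (\<sigma> i) (\<sigma> j))
        * (\<Prod>(i, j)\<in>{(i, j). Suc s \<le> i \<and> i < j \<and> j < t}. \<phi> (\<sigma> i) (\<sigma> j))"
    unfolding pairs using fin by (intro prod.union_disjoint) auto
  also have "(\<Prod>(i, j)\<in>{s} \<times> {Suc s..<t}. \<phi> (\<sigma> i) (\<sigma> j)) = (\<Prod>b\<in>\<sigma> ` {Suc s..<t}. \<phi> (\<sigma> s) b)"
    using inj by (simp add: prod.cartesian_product[symmetric] prod.reindex)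
  finally show ?case
    using st Suc.hyps(1)[of "Suc s"] Suc.hyps(2) inj
    by (simp add: upt_rec[of s t] prod.atLeast_Suc_lessThan mult_ac)
qed

text \<open>
  Both sides are sums over the orderings of \<open>{1..r}\<close>, given as lists of values of \<open>\<sigma>\<close>.
\<close>
lemma sum_permutes_eq_symmetrization:
  "(\<Sum>\<sigma> | \<sigma> permutes {1..r}. (\<Prod>j\<in>{1..r}. g j (\<sigma> j))
      * (\<Prod>(i, j)\<in>{(i, j). 1 \<le> i \<and> i < j \<and> j \<le> r}. \<phi> (\<sigma> i) (\<sigma> j)))
    = symmetrization \<phi> (map g [1..<Suc r]) {1..r}"
proof -
  have bij: "bij_betw (\<lambda>\<sigma>. map \<sigma> [1..<Suc r]) {\<sigma>. \<sigma> permutes {1..r}} (permutations_of_set {1..r})"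
    unfolding bij_betw_def
  proof (intro conjI equalityI subsetI)
    show "inj_on (\<lambda>\<sigma>. map \<sigma> [1..<Suc r]) {\<sigma>. \<sigma> permutes {1..r}}"
    proof (rule inj_onI, rule ext)
      fix \<sigma> \<tau> j
      assume *: "\<sigma> \<in> {\<sigma>. \<sigma> permutes {1..r}}" "\<tau> \<in> {\<sigma>. \<sigma> permutes {1..r}}"
        "map \<sigma> [1..<Suc r] = map \<tau> [1..<Suc r]"
      then have "\<forall>j\<in>set [1..<Suc r]. \<sigma> j = \<tau> j" by (simp only: map_eq_conv)
      then have "\<sigma> j = \<tau> j" if "j \<in> {1..r}" using that by (simp del: upt_Suc)
      then show "\<sigma> j = \<tau> j"
        using * permutes_not_in[of \<sigma> "{1..r}" j] permutes_not_in[of \<tau> "{1..r}" j]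
        by (cases "j \<in> {1..r}") auto
    qed
  next
    fix as assume "as \<in> (\<lambda>\<sigma>. map \<sigma> [1..<Suc r]) ` {\<sigma>. \<sigma> permutes {1..r}}"
    then obtain \<sigma> where \<sigma>: "\<sigma> permutes {1..r}" "as = map \<sigma> [1..<Suc r]" by auto
    have "set [1..<Suc r] = {1..r}" by auto
    then show "as \<in> permutations_of_set {1..r}"
      unfolding \<sigma>(2) using permutes_image[OF \<sigma>(1)] permutes_inj_on[OF \<sigma>(1)]
      by (intro permutations_of_setI) (simp_all only: set_map distinct_map distinct_upt)
  next
    fix as assume as: "as \<in> permutations_of_set {1..r}"
    then have set: "set as = {1..r}" and dist: "distinct as" by (auto dest: permutations_of_setD)
    have len: "length as = r" using distinct_card[OF dist] set by simp
    define \<sigma> where "\<sigma> = (\<lambda>j. if j \<in> {1..r} then as ! (j - 1) else j)"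
    have map: "map \<sigma> [1..<Suc r] = as"
      by (rule nth_equalityI) (auto simp: len \<sigma>_def simp del: upt_Suc)
    have "\<sigma> ` {1..r} = {1..r}"
    proof -
      have "\<sigma> ` set [1..<Suc r] = {1..r}" using map set by (metis set_map)
      moreover have "set [1..<Suc r] = {1..r}" by auto
      ultimately show ?thesis by simp
    qed
    moreover from this have "inj_on \<sigma> {1..r}" by (intro eq_card_imp_inj_on) auto
    ultimately have "\<sigma> permutes {1..r}"
      by (intro bij_imp_permutes) (auto simp: bij_betw_def \<sigma>_def)
    then show "as \<in> (\<lambda>\<sigma>. map \<sigma> [1..<Suc r]) ` {\<sigma>. \<sigma> permutes {1..r}}"
      using map by (intro image_eqI[of _ _ \<sigma>]) auto
  qed
  have "symmetrization \<phi> (map g [1..<Suc r]) {1..r}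
      = (\<Sum>as\<in>permutations_of_set {1..r}. ordering_weight \<phi> (map g [1..<Suc r]) as)"
    by (intro symmetrization_eq_sum_orderings) auto
  also have "\<dots> = (\<Sum>\<sigma> | \<sigma> permutes {1..r}. ordering_weight \<phi> (map g [1..<Suc r]) (map \<sigma> [1..<Suc r]))"
    by (rule sum.reindex_bij_betw[OF bij, symmetric])
  also have "\<dots> = (\<Sum>\<sigma> | \<sigma> permutes {1..r}. (\<Prod>j\<in>{1..r}. g j (\<sigma> j))
      * (\<Prod>(i, j)\<in>{(i, j). 1 \<le> i \<and> i < j \<and> j \<le> r}. \<phi> (\<sigma> i) (\<sigma> j)))"
  proof (intro sum.cong refl)
    fix \<sigma> assume "\<sigma> \<in> {\<sigma>. \<sigma> permutes {1..r}}"
    then have "inj_on \<sigma> {1..<Suc r}" by (auto intro: permutes_inj_on)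
    from ordering_weight_upt[OF this, of \<phi> g]
    show "ordering_weight \<phi> (map g [1..<Suc r]) (map \<sigma> [1..<Suc r]) = (\<Prod>j\<in>{1..r}. g j (\<sigma> j))
      * (\<Prod>(i, j)\<in>{(i, j). 1 \<le> i \<and> i < j \<and> j \<le> r}. \<phi> (\<sigma> i) (\<sigma> j))"
      by (simp only: less_Suc_eq_le atLeastLessThanSuc_atLeastAtMost)
  qed
  finally show ?thesis ..
qed


section \<open>F and Fbar as symmetrizations\<close>

definition site_weight :: "'a::field \<Rightarrow> nat \<Rightarrow> (nat \<Rightarrow> 'a) \<Rightarrow> nat \<Rightarrow> 'a \<Rightarrow> 'a" where
  "site_weight q M w x s = (\<Prod>i\<in>{x + 1..M}. s - q * w i) * (\<Prod>i\<in>{1..<x}. s - w i) * ((1 - q) * s)"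

lemma F_eq_symmetrization:
  "F q M r u w x = symmetrization (\<lambda>i j. (q * u i - u j) / (u i - u j))
     (map (\<lambda>j a. site_weight q M w (x j) (u a)) [1..<Suc r]) {1..r}"
  unfolding F_def sum_permutes_eq_symmetrization[symmetric] site_weight_def prod.distrib
  by (intro sum.cong refl) (simp only: mult_ac)

lemma F_reindex:
  assumes "bij_betw e {1..r} A"
  shows "F q M r (\<lambda>j. u (e j)) w x = symmetrization (\<lambda>i j. (q * u i - u j) / (u i - u j))
     (map (\<lambda>j a. site_weight q M w (x j) (u a)) [1..<Suc r]) A"
proof -
  have "A = e ` {1..r}" "inj_on e {1..r}" using assms by (auto simp: bij_betw_def)
  then show ?thesis
    unfolding F_eq_symmetrization by (simp only: symmetrization_image map_map comp_def)
qed

lemma F_on_eq_symmetrization: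
  assumes "finite A" "card A = r"
  shows "F_on q M r A u w x = symmetrization (\<lambda>i j. (q * u i - u j) / (u i - u j))
     (map (\<lambda>j a. site_weight q M w (x j) (u a)) [1..<Suc r]) A"
proof -
  obtain e where e: "bij_betw e {1..r} A"
    using assms ex_bij_betw_nat_finite_1 by blast
  show ?thesis unfolding F_on_eq[OF e] by (rule F_reindex[OF e])
qed

lemma site_weight_extend:
  assumes "x \<le> m"
  shows "site_weight q (m + d) w x s = (\<Prod>i\<in>{m + 1..m + d}. s - q * w i) * site_weight q m w x s"
proof -
  have "{x + 1..m + d} = {m + 1..m + d} \<union> {x + 1..m}" using assms by auto
  then have "(\<Prod>i\<in>{x + 1..m + d}. s - q * w i)
      = (\<Prod>i\<in>{m + 1..m + d}. s - q * w i) * (\<Prod>i\<in>{x + 1..m}. s - q * w i)"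
    by (simp add: prod.union_disjoint disjoint_iff)
  then show ?thesis unfolding site_weight_def by (simp only: mult_ac)
qed

text \<open>
  The first factors \<open>u a - w i\<close> of a site at \<open>j\<close> are shared with all later sites; collecting them
  for the rows that remain gives the factors \<open>b - v\<close> in the recursion of \<open>dwpf\<close>.
\<close>
lemma symmetrization_consecutive_sites:
  assumes "finite A" "s + card A = M" "inj_on u A" "inj_on w {Suc s..M}"
  shows "symmetrization (\<lambda>i j. (q * u i - u j) / (u i - u j))
      (map (\<lambda>j a. site_weight q M w j (u a)) [Suc s..<Suc M]) A
    = (\<Prod>a\<in>A. \<Prod>i\<in>{1..s}. u a - w i) * dwpf q (map w [Suc s..<Suc M]) (u ` A)"
  using assms
proof (induction "card A" arbitrary: A s)
  case 0
  then show ?case by simp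
next
  case (Suc c)
  have upt: "[Suc s..<Suc M] = Suc s # [Suc (Suc s)..<Suc M]"
    using Suc by (simp add: upt_rec[of "Suc s"])
  have set: "set (map w [Suc (Suc s)..<Suc M]) = w ` {Suc s + 1..M}" by auto
  have inj_w: "inj_on w {Suc s + 1..M}" using Suc.prems(4) by (rule inj_on_subset) auto
  show ?case
    unfolding upt list.map symmetrization.simps dwpf.simps sum.reindex[OF Suc.prems(3)]
      sum_distrib_left comp_def set prod.reindex[OF inj_w]
  proof (intro sum.cong refl)
    fix a assume a: "a \<in> A"
    have image: "u ` A - {u a} = u ` (A - {a})"
      using Suc.prems(3) a by (auto simp: inj_on_def)
    have inj_u: "inj_on u (A - {a})" using Suc.prems(3) by (rule inj_on_diff)
    have card: "card (A - {a}) = c" using a Suc by simp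
    have IH: "symmetrization (\<lambda>i j. (q * u i - u j) / (u i - u j))
        (map (\<lambda>j a. site_weight q M w j (u a)) [Suc (Suc s)..<Suc M]) (A - {a})
      = (\<Prod>a\<in>A - {a}. \<Prod>i\<in>{1..Suc s}. u a - w i)
        * dwpf q (map w [Suc (Suc s)..<Suc M]) (u ` (A - {a}))"
      using Suc.prems Suc.hyps(2) card inj_u inj_w by (intro Suc.hyps(1)) auto
    have split: "(\<Prod>a\<in>A. \<Prod>i\<in>{1..s}. u a - w i)
        = (\<Prod>i\<in>{1..s}. u a - w i) * (\<Prod>a\<in>A - {a}. \<Prod>i\<in>{1..s}. u a - w i)"
      using a Suc.prems by (intro prod.remove) auto
    have last: "(\<Prod>i\<in>{1..Suc s}. u a - w i) = (\<Prod>i\<in>{1..s}. u a - w i) * (u a - w (Suc s))" for a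
      by simp
    show "site_weight q M w (Suc s) (u a) * (\<Prod>b\<in>A - {a}. (q * u a - u b) / (u a - u b))
        * symmetrization (\<lambda>i j. (q * u i - u j) / (u i - u j))
          (map (\<lambda>j a. site_weight q M w j (u a)) [Suc (Suc s)..<Suc M]) (A - {a})
      = (\<Prod>a\<in>A. \<Prod>i\<in>{1..s}. u a - w i)
        * ((1 - q) * u a * (\<Prod>x\<in>{Suc s + 1..M}. u a - q * w x)
        * (\<Prod>b\<in>u ` A - {u a}. (q * u a - b) / (u a - b) * (b - w (Suc s)))
        * dwpf q (map w [Suc (Suc s)..<Suc M]) (u ` A - {u a}))"
      unfolding IH unfolding split image prod.reindex[OF inj_u] site_weight_def comp_def prod.distrib last
        atLeastLessThanSuc_atLeastAtMost
      by (simp only: mult_ac)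
  qed
qed

definition row_weight :: "'a::field \<Rightarrow> nat \<Rightarrow> (nat \<Rightarrow> 'a) \<Rightarrow> nat \<Rightarrow> 'a \<Rightarrow> 'a" where
  "row_weight q n u y s = (\<Prod>i\<in>{y + 1..n}. q * (u i - s)) * (\<Prod>i\<in>{1..<y}. u i - q * s) * ((1 - q) * u y)"

text \<open>
  \<open>Fbar\<close> with the column variables given as a set, so that a column can be removed.
\<close>
definition Fbar_on :: "'a::field \<Rightarrow> nat \<Rightarrow> (nat \<Rightarrow> 'a) \<Rightarrow> 'a set \<Rightarrow> (nat \<Rightarrow> nat) \<Rightarrow> 'a" where
  "Fbar_on q n u V y = symmetrization (\<lambda>s t. (q * s - t) / (q * (s - t)))
     (map (\<lambda>j. row_weight q n u (y j)) [1..<Suc (card V)]) V"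

lemma Fbar_eq_Fbar_on:
  assumes "inj_on v {1..r}"
  shows "Fbar q n r v u y = Fbar_on q n u (v ` {1..r}) y"
proof -
  have "Fbar q n r v u y = symmetrization (\<lambda>i j. (q * v i - v j) / (q * (v i - v j)))
     (map (\<lambda>j a. row_weight q n u (y j) (v a)) [1..<Suc r]) {1..r}"
    unfolding Fbar_def sum_permutes_eq_symmetrization[symmetric] row_weight_def prod.distrib
    by (intro sum.cong refl) (simp only: mult_ac)
  then show ?thesis
    unfolding Fbar_on_def using assms
    by (simp add: symmetrization_image card_image comp_def del: upt_Suc)
qed

lemma row_weight_Suc:
  "y \<le> N \<Longrightarrow> row_weight q (Suc N) u y s = q * (u (Suc N) - s) * row_weight q N u y s"
  unfolding row_weight_def by simp

lemma Fbar_on_Suc: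
  assumes "finite V" "\<And>j. j \<in> {1..card V} \<Longrightarrow> y j \<le> N"
  shows "Fbar_on q (Suc N) u V y = (\<Prod>s\<in>V. q * (u (Suc N) - s)) * Fbar_on q N u V y"
proof -
  have "Fbar_on q (Suc N) u V y = symmetrization (\<lambda>s t. (q * s - t) / (q * (s - t)))
     (map (\<lambda>j s. q * (u (Suc N) - s) * row_weight q N u (y j) s) [1..<Suc (card V)]) V"
    unfolding Fbar_on_def using assms by (intro symmetrization_cong row_weight_Suc) auto
  then show ?thesis
    unfolding Fbar_on_def using assms(1) by (simp add: symmetrization_weight del: upt_Suc)
qed

definition last_row_coeff :: "'a::field \<Rightarrow> nat \<Rightarrow> (nat \<Rightarrow> 'a) \<Rightarrow> 'a set \<Rightarrow> 'a \<Rightarrow> 'a" where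
  "last_row_coeff q N u V l = (1 - q) * u (Suc N) * (\<Prod>i\<in>{1..N}. u i - q * l)
     * (\<Prod>s\<in>V - {l}. (u (Suc N) - s) * ((q * s - l) / (s - l)))"

text \<open>
  The last entry of \<open>y\<close> is taken by some column \<open>l\<close>; every other column crosses the row
  \<open>Suc N\<close> with weight \<open>q * (u (Suc N) - s)\<close>, and the \<open>q\<close> cancels against the kernel of \<open>Fbar\<close>.
\<close>
lemma Fbar_on_at_last_row:
  assumes "q \<noteq> 0" "finite V" "card V = Suc e" "\<And>j. j \<in> {1..e} \<Longrightarrow> y j \<le> N"
  shows "Fbar_on q (Suc N) u V (y(Suc e := Suc N))
    = (\<Sum>l\<in>V. last_row_coeff q N u V l * Fbar_on q N u (V - {l}) y)"
proof -
  have upt: "[1..<Suc (Suc e)] = [1..<Suc e] @ [Suc e]" by simp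
  show ?thesis
    unfolding Fbar_on_def assms(3) upt map_append list.map
  proof (subst symmetrization_snoc, (use assms in \<open>simp_all del: upt_Suc\<close>)[2], intro sum.cong refl)
    fix l assume l: "l \<in> V"
    then have card: "card (V - {l}) = e" using assms by simp
    have "symmetrization (\<lambda>s t. (q * s - t) / (q * (s - t)))
         (map (\<lambda>j. row_weight q (Suc N) u ((y(Suc e := Suc N)) j)) [1..<Suc e]) (V - {l})
      = Fbar_on q (Suc N) u (V - {l}) y"
      unfolding Fbar_on_def card by (intro symmetrization_cong) auto
    also have "\<dots> = (\<Prod>s\<in>V - {l}. q * (u (Suc N) - s)) * Fbar_on q N u (V - {l}) y"
      using assms card by (intro Fbar_on_Suc) auto
    finally have rest: "symmetrization (\<lambda>s t. (q * s - t) / (q * (s - t)))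
         (map (\<lambda>j. row_weight q (Suc N) u ((y(Suc e := Suc N)) j)) [1..<Suc e]) (V - {l}) = \<dots>" .
    have cancel: "(\<Prod>s\<in>V - {l}. q * (u (Suc N) - s)) * (\<Prod>s\<in>V - {l}. (q * s - l) / (q * (s - l)))
      = (\<Prod>s\<in>V - {l}. (u (Suc N) - s) * ((q * s - l) / (s - l)))"
      unfolding prod.distrib[symmetric] using assms(1) by (intro prod.cong refl) simp
    have last: "row_weight q (Suc N) u (Suc N) l = (1 - q) * u (Suc N) * (\<Prod>i\<in>{1..N}. u i - q * l)"
      unfolding row_weight_def by (simp add: atLeastLessThanSuc_atLeastAtMost)
    show "symmetrization (\<lambda>s t. (q * s - t) / (q * (s - t)))
         (map (\<lambda>j. row_weight q (Suc N) u ((y(Suc e := Suc N)) j)) [1..<Suc e]) (V - {l})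
       * (\<Prod>b\<in>V - {l}. (q * b - l) / (q * (b - l))) * row_weight q (Suc N) u ((y(Suc e := Suc N)) (Suc e)) l
      = last_row_coeff q N u V l * symmetrization (\<lambda>s t. (q * s - t) / (q * (s - t)))
         (map (\<lambda>j. row_weight q N u (y j)) [1..<Suc (card (V - {l}))]) (V - {l})"
      unfolding rest fun_upd_same last last_row_coeff_def Fbar_on_def[symmetric] cancel[symmetric]
      by (simp only: mult_ac)
  qed
qed


section \<open>Sums over increasing and over distinct sequences\<close>

lemma incr_seqs_0: "incr_seqs 0 n = {\<lambda>_. undefined}"
  by (auto simp: incr_seqs_def strict_mono_on_def)

lemma dist_seqs_0: "dist_seqs 0 y = {\<lambda>_. undefined}"
  by (auto simp: dist_seqs_def)

lemma incr_seqs_Suc_0: "incr_seqs (Suc e) 0 = {}"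
  by (auto simp: incr_seqs_def PiE_def Pi_def)

lemma finite_incr_seqs: "finite (incr_seqs d n)"
  unfolding incr_seqs_def by (rule finite_subset[OF _ finite_PiE[of "{1..d}" "\<lambda>_. {1..n}"]]) auto

lemma finite_dist_seqs: "finite (dist_seqs d y)"
  unfolding dist_seqs_def by (rule finite_subset[OF _ finite_PiE[of "{1..d}" "\<lambda>j. {1..y j}"]]) auto

lemma incr_seqs_le: "y \<in> incr_seqs d n \<Longrightarrow> j \<in> {1..d} \<Longrightarrow> y j \<le> n"
  by (auto simp: incr_seqs_def dest: PiE_mem)

lemma sum_incr_seqs_Suc:
  "(\<Sum>y\<in>incr_seqs (Suc e) (Suc N). f y)
    = (\<Sum>y\<in>incr_seqs (Suc e) N. f y) + (\<Sum>y\<in>incr_seqs e N. f (y(Suc e := Suc N)))"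
proof -
  let ?ext = "\<lambda>y. y(Suc e := Suc N)"
  have ext_mem: "?ext y \<in> incr_seqs (Suc e) (Suc N)" if "y \<in> incr_seqs e N" for y :: "nat \<Rightarrow> nat"
  proof -
    have "y j \<in> {1..N}" if "j \<in> {1..e}" for j
      using \<open>y \<in> incr_seqs e N\<close> that by (auto simp: incr_seqs_def dest: PiE_mem)
    moreover have "y j = undefined" if "j \<notin> {1..e}" for j
      using \<open>y \<in> incr_seqs e N\<close> that by (auto simp: incr_seqs_def PiE_def extensional_def)
    moreover have "y i < y j" if "i \<in> {1..e}" "j \<in> {1..e}" "i < j" for i j
      using \<open>y \<in> incr_seqs e N\<close> that by (auto simp: incr_seqs_def strict_mono_on_def)
    ultimately show ?thesis
      unfolding incr_seqs_def
      by (intro CollectI conjI PiE_I strict_mono_onI) (auto simp: less_Suc_eq_le le_Suc_eq)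
  qed
  have old: "incr_seqs (Suc e) N \<subseteq> incr_seqs (Suc e) (Suc N)"
    by (auto simp: incr_seqs_def PiE_def Pi_def)
  have split: "y \<in> incr_seqs (Suc e) N \<union> ?ext ` incr_seqs e N" if y: "y \<in> incr_seqs (Suc e) (Suc N)" for y
  proof (cases "y (Suc e) = Suc N")
    case True
    have mono: "y i < y j" if "1 \<le> i" "i < j" "j \<le> Suc e" for i j
      using y that by (auto simp: incr_seqs_def strict_mono_on_def)
    have range: "y j \<in> {1..Suc N}" if "j \<in> {1..Suc e}" for j
      using y that by (auto simp: incr_seqs_def dest: PiE_mem)
    have "y(Suc e := undefined) \<in> incr_seqs e N"
    proof -
      have "y j \<in> {1..N}" if "j \<in> {1..e}" for j
        using mono[of j "Suc e"] range[of j] that True by auto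
      moreover have "y j = undefined" if "j \<notin> {1..Suc e}" for j
        using y that by (auto simp: incr_seqs_def PiE_def extensional_def)
      ultimately show ?thesis
        unfolding incr_seqs_def using mono
        by (intro CollectI conjI PiE_I strict_mono_onI) auto
    qed
    moreover have "y = ?ext (y(Suc e := undefined))" using True by auto
    ultimately show ?thesis by blast
  next
    case False
    have "y j \<le> N" if "j \<in> {1..Suc e}" for j
    proof -
      have "y j \<le> y (Suc e)"
        using y that by (cases "j = Suc e") (auto simp: incr_seqs_def strict_mono_on_def less_imp_le)
      also have "\<dots> \<le> N" using incr_seqs_le[OF y, of "Suc e"] False by simp
      finally show ?thesis .
    qed
    then show ?thesis using y by (auto simp: incr_seqs_def PiE_def Pi_def)
  qed
  have "incr_seqs (Suc e) (Suc N) = incr_seqs (Suc e) N \<union> ?ext ` incr_seqs e N"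
    using ext_mem old split by blast
  moreover have "incr_seqs (Suc e) N \<inter> ?ext ` incr_seqs e N = {}"
    using incr_seqs_le[of _ "Suc e" N "Suc e"] by force
  moreover have "inj_on ?ext (incr_seqs e N)"
  proof (rule inj_onI, rule ext)
    fix y z j assume *: "y \<in> incr_seqs e N" "z \<in> incr_seqs e N" "?ext y = ?ext z"
    show "y j = z j"
    proof (cases "j = Suc e")
      case True
      then show ?thesis using * by (auto simp: incr_seqs_def PiE_def extensional_def)
    next
      case False
      then show ?thesis using fun_cong[OF *(3), of j] by simp
    qed
  qed
  ultimately show ?thesis
    by (simp add: sum.union_disjoint finite_incr_seqs sum.reindex)
qed

lemma sum_dist_seqs_Suc:
  "(\<Sum>a\<in>dist_seqs (Suc e) (y(Suc e := n)). f a)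
    = (\<Sum>a\<in>dist_seqs e y. \<Sum>b\<in>{1..n} - a ` {1..e}. f (a(Suc e := b)))"
proof -
  have "(\<Sum>a\<in>dist_seqs e y. \<Sum>b\<in>{1..n} - a ` {1..e}. f (a(Suc e := b)))
      = (\<Sum>(a, b)\<in>(SIGMA a:dist_seqs e y. {1..n} - a ` {1..e}). f (a(Suc e := b)))"
    using finite_dist_seqs by (intro sum.Sigma) auto
  also have "\<dots> = (\<Sum>a\<in>dist_seqs (Suc e) (y(Suc e := n)). f a)"
  proof (rule sum.reindex_bij_witness[where i = "\<lambda>a. (a(Suc e := undefined), a (Suc e))"
        and j = "\<lambda>(a, b). a(Suc e := b)"], goal_cases)
    case (1 z)
    then show ?case by (auto simp: dist_seqs_def PiE_def extensional_def)
  next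
    case (2 z)
    obtain a b where z: "z = (a, b)" "a \<in> dist_seqs e y" "b \<in> {1..n}" "b \<notin> a ` {1..e}"
      using 2 by auto
    have "inj_on (a(Suc e := b)) {1..Suc e}"
    proof -
      have set: "{1..Suc e} = insert (Suc e) {1..e}" "{1..e} - {Suc e} = {1..e}" by auto
      have "(a(Suc e := b)) ` {1..e} = a ` {1..e}" by (intro image_cong) auto
      moreover have "inj_on (a(Suc e := b)) {1..e} = inj_on a {1..e}"
        by (intro inj_on_cong) auto
      ultimately show ?thesis
        using z(2,4) unfolding set inj_on_insert fun_upd_same by (simp add: dist_seqs_def)
    qed
    moreover have "(a(Suc e := b)) j \<in> {1..(y(Suc e := n)) j}" if "j \<in> {1..Suc e}" for j
    proof (cases "j = Suc e")
      case False
      then have "a j \<in> {1..y j}"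
        using z(2) that by (intro PiE_mem[of a "{1..e}"]) (auto simp: dist_seqs_def)
      then show ?thesis using False by simp
    qed (use z(3) in simp)
    moreover have "a j = undefined" if "j \<notin> {1..e}" for j
      using z(2) that by (auto simp: dist_seqs_def PiE_def extensional_def)
    ultimately show ?case
      unfolding z(1) prod.case dist_seqs_def by (intro CollectI conjI PiE_I) auto
  next
    case (3 a)
    then show ?case by auto
  next
    case (4 a)
    have inj: "inj_on a {1..Suc e}" using 4 by (simp add: dist_seqs_def)
    have bound: "a j \<in> {1..(y(Suc e := n)) j}" if "j \<in> {1..Suc e}" for j
      using 4 that by (intro PiE_mem[of a "{1..Suc e}"]) (simp_all only: dist_seqs_def mem_Collect_eq)
    have "(a(Suc e := undefined)) ` {1..e} = a ` {1..e}" by (intro image_cong) auto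
    moreover have "a (Suc e) \<notin> a ` {1..e}"
      using inj inj_on_image_mem_iff[OF inj, of "Suc e" "{1..e}"] by auto
    moreover have "a (Suc e) \<in> {1..n}"
      using bound[of "Suc e"] by simp
    moreover have "a(Suc e := undefined) \<in> dist_seqs e y"
    proof -
      have "a j \<in> {1..y j}" if "j \<in> {1..e}" for j
        using bound[of j] that by simp
      moreover have "a j = undefined" if "j \<notin> {1..Suc e}" for j
        using 4 that by (auto simp: dist_seqs_def PiE_def extensional_def)
      moreover have "inj_on (a(Suc e := undefined)) {1..e} = inj_on a {1..e}"
        by (intro inj_on_cong) auto
      moreover have "inj_on a {1..e}" using inj by (rule inj_on_subset) auto
      ultimately show ?thesis
        unfolding dist_seqs_def by (intro CollectI conjI PiE_I) auto
    qed
    ultimately show ?case by auto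
  next
    case (5 a)
    then show ?case by auto
  qed
  finally show ?thesis ..
qed

lemma sum_subsets_atMost_Suc:
  "(\<Sum>A | A \<subseteq> {1..Suc N} \<and> card A = Suc e. f A)
    = (\<Sum>A | A \<subseteq> {1..N} \<and> card A = Suc e. f A) + (\<Sum>B | B \<subseteq> {1..N} \<and> card B = e. f (insert (Suc N) B))"
proof -
  have "{A. A \<subseteq> {1..Suc N} \<and> card A = Suc e}
      = {A. A \<subseteq> {1..N} \<and> card A = Suc e} \<union> insert (Suc N) ` {B. B \<subseteq> {1..N} \<and> card B = e}"
  proof (intro equalityI subsetI)
    fix A assume A: "A \<in> {A. A \<subseteq> {1..Suc N} \<and> card A = Suc e}"
    show "A \<in> {A. A \<subseteq> {1..N} \<and> card A = Suc e} \<union> insert (Suc N) ` {B. B \<subseteq> {1..N} \<and> card B = e}"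
    proof (cases "Suc N \<in> A")
      case True
      then have "A = insert (Suc N) (A - {Suc N})" "card (A - {Suc N}) = e" "A - {Suc N} \<subseteq> {1..N}"
        using A by (auto simp: atLeastAtMostSuc_conv)
      then show ?thesis by blast
    next
      case False
      then show ?thesis using A by (auto simp: atLeastAtMostSuc_conv)
    qed
  next
    fix A assume "A \<in> {A. A \<subseteq> {1..N} \<and> card A = Suc e} \<union> insert (Suc N) ` {B. B \<subseteq> {1..N} \<and> card B = e}"
    then show "A \<in> {A. A \<subseteq> {1..Suc N} \<and> card A = Suc e}"
    proof (elim UnE imageE)
      fix B assume B: "A = insert (Suc N) B" "B \<in> {B. B \<subseteq> {1..N} \<and> card B = e}"
      then have "finite B" "Suc N \<notin> B" using finite_subset by auto
      then show ?thesis using B by auto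
    qed auto
  qed
  moreover have "{A. A \<subseteq> {1..N} \<and> card A = Suc e} \<inter> insert (Suc N) ` {B. B \<subseteq> {1..N} \<and> card B = e} = {}"
    by auto
  moreover have "inj_on (insert (Suc N)) {B. B \<subseteq> {1..N} \<and> card B = e}"
  proof (rule inj_onI)
    fix B B' assume "B \<in> {B. B \<subseteq> {1..N} \<and> card B = e}" "B' \<in> {B. B \<subseteq> {1..N} \<and> card B = e}"
      "insert (Suc N) B = insert (Suc N) B'"
    moreover from this have "Suc N \<notin> B" "Suc N \<notin> B'" by auto
    ultimately show "B = B'" by (simp add: insert_ident)
  qed
  ultimately show ?thesis
    by (simp add: sum.union_disjoint sum.reindex)
qed


section \<open>Adding a row\<close>

text \<open>
  The weight of the last columns \<open>vs\<close> when exactly the rows in \<open>A\<close>, out of \<open>n\<close>, end there: every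
  other row passes straight through all the columns and, in the symmetrization, precedes the rows in \<open>A\<close>.
\<close>
definition split_weight :: "'a::field \<Rightarrow> (nat \<Rightarrow> 'a) \<Rightarrow> nat \<Rightarrow> nat set \<Rightarrow> 'a list \<Rightarrow> 'a" where
  "split_weight q u n A vs = (\<Prod>c\<in>{1..n} - A. \<Prod>t\<in>set vs. u c - q * t)
     * (\<Prod>c\<in>{1..n} - A. \<Prod>a\<in>A. (q * u c - u a) / (u c - u a)) * dwpf q vs (u ` A)"

text \<open>
  The last factor of \<open>path_weight\<close>, for a row at \<open>Suc N\<close> moved past the rows outside of \<open>B\<close>.
\<close>
definition exchange_coeff :: "'a::field \<Rightarrow> (nat \<Rightarrow> 'a) \<Rightarrow> nat \<Rightarrow> nat set \<Rightarrow> nat \<Rightarrow> 'a" where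
  "exchange_coeff q u N B a = (\<Prod>b\<in>{1..N} - B. u a - q * u b) / (\<Prod>b\<in>{1..Suc N} - insert a B. u a - u b)"

text \<open>
  The genericity of the columns which makes the interpolation points distinct and nonzero.
\<close>
definition admissible :: "(nat \<Rightarrow> 'a::field) \<Rightarrow> 'a list \<Rightarrow> bool" where
  "admissible u vs \<longleftrightarrow> distinct vs \<and> 0 \<notin> set vs \<and> set vs \<inter> range u = {}"

lemma quotient_flip: "(a - q * b) / (a - b) = (q * b - a) / (b - (a::'a::field))"
  by (metis minus_diff_eq minus_divide_divide)

text \<open>
  The coefficient with which moving the rows \<open>y\<close> to the front, one after the other, picks out
  the variables \<open>u (a j)\<close>.
\<close>
definition path_weight :: "'a::field \<Rightarrow> (nat \<Rightarrow> 'a) \<Rightarrow> nat \<Rightarrow> (nat \<Rightarrow> nat) \<Rightarrow> (nat \<Rightarrow> nat) \<Rightarrow> 'a" where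
  "path_weight q u d y a = (\<Prod>j\<in>{1..d}. \<Prod>b\<in>{1..<y j} - a ` {1..<j}. u (a j) - q * u b)
     / (\<Prod>j\<in>{1..d}. \<Prod>b\<in>{1..y j} - a ` {1..j}. u (a j) - u b)"

lemma path_weight_Suc:
  "path_weight q u (Suc e) (y(Suc e := Suc N)) (a(Suc e := b))
    = path_weight q u e y a * exchange_coeff q u N (a ` {1..e}) b"
proof -
  have image: "(a(Suc e := b)) ` {1..<j} = a ` {1..<j}" if "j \<le> Suc e" for j
    using that by (intro image_cong) auto
  have image': "(a(Suc e := b)) ` {1..j} = a ` {1..j}" if "j \<le> e" for j
    using that by (intro image_cong) auto
  have last: "(a(Suc e := b)) ` {1..Suc e} = insert b (a ` {1..e})"
    unfolding atLeastAtMostSuc_conv[of 1 e, simplified] by auto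
  have 1: "(\<Prod>j\<in>{1..e}. \<Prod>c\<in>{1..<(y(Suc e := Suc N)) j} - (a(Suc e := b)) ` {1..<j}. u ((a(Suc e := b)) j) - q * u c)
      = (\<Prod>j\<in>{1..e}. \<Prod>c\<in>{1..<y j} - a ` {1..<j}. u (a j) - q * u c)"
    by (intro prod.cong refl) (auto simp: image)
  have 2: "(\<Prod>j\<in>{1..e}. \<Prod>c\<in>{1..(y(Suc e := Suc N)) j} - (a(Suc e := b)) ` {1..j}. u ((a(Suc e := b)) j) - u c)
      = (\<Prod>j\<in>{1..e}. \<Prod>c\<in>{1..y j} - a ` {1..j}. u (a j) - u c)"
    by (intro prod.cong refl) (auto simp: image')
  have Suc: "(\<Prod>j\<in>{1..Suc e}. f j) = (\<Prod>j\<in>{1..e}. f j) * f (Suc e)" for f :: "nat \<Rightarrow> 'a" by simp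
  show ?thesis
    unfolding path_weight_def exchange_coeff_def Suc 1 2 last fun_upd_same
      atLeastLessThanSuc_atLeastAtMost image'[OF order_refl] times_divide_times_eq ..
qed

context
  fixes q :: "'a::field" and u :: "nat \<Rightarrow> 'a"
  assumes q: "q \<noteq> 0" and inj_u: "inj u" and u_nz: "0 \<notin> range u"
begin

lemma sum_last_row_coeff:
  assumes "admissible u vs" "B \<subseteq> {1..N}" "length vs = Suc (card B)"
  shows "(\<Sum>l\<in>set vs. last_row_coeff q N u (set vs) l * split_weight q u N B (remove1 l vs))
    = (\<Prod>c\<in>{1..N} - B. \<Prod>t\<in>set vs. u c - q * t)
     * (\<Prod>c\<in>{1..N} - B. \<Prod>b\<in>B. (q * u c - u b) / (u c - u b)) * dwpf q vs (insert (u (Suc N)) (u ` B))"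
proof -
  have vs: "distinct vs" "0 \<notin> set vs" "set vs \<inter> range u = {}"
    using assms(1) by (auto simp: admissible_def)
  have fin: "finite B" using assms(2) finite_subset by blast
  have inj: "inj_on u B" using inj_u inj_on_subset by blast
  have "dwpf q vs (insert (u (Suc N)) (u ` B)) = u (Suc N) * row_poly q vs (u ` B) (u (Suc N))"
  proof (rule dwpf_row_expansion[OF vs(1) _ _ _ vs(2)])
    show "length vs = Suc (card (u ` B))" using assms(3) inj by (simp add: card_image)
    show "u (Suc N) \<notin> u ` B" using assms(2) inj_u by (auto dest: injD)
  qed (use fin vs in auto)
  also have "\<dots> = (\<Sum>l\<in>set vs. (1 - q) * u (Suc N) * (\<Prod>b\<in>B. u b - q * l)
     * (\<Prod>j\<in>set vs - {l}. (u (Suc N) - j) * ((q * j - l) / (j - l))) * dwpf q (remove1 l vs) (u ` B))"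
    unfolding row_poly_def sum_distrib_left prod.reindex[OF inj] comp_def
    by (intro sum.cong refl) (simp only: mult_ac)
  finally have expansion: "dwpf q vs (insert (u (Suc N)) (u ` B)) = \<dots>" .
  show ?thesis
    unfolding expansion sum_distrib_left
  proof (intro sum.cong refl)
    fix l assume l: "l \<in> set vs"
    have "(\<Prod>i\<in>{1..N}. u i - q * l) = (\<Prod>c\<in>{1..N} - B. u c - q * l) * (\<Prod>b\<in>B. u b - q * l)"
      using assms(2) by (intro prod.subset_diff) auto
    moreover have "(\<Prod>c\<in>{1..N} - B. \<Prod>t\<in>set vs. u c - q * t)
        = (\<Prod>c\<in>{1..N} - B. u c - q * l) * (\<Prod>c\<in>{1..N} - B. \<Prod>t\<in>set vs - {l}. u c - q * t)"
      unfolding prod.distrib[symmetric] using l by (intro prod.cong refl prod.remove) auto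
    moreover have "set (remove1 l vs) = set vs - {l}" using vs(1) by simp
    ultimately show "last_row_coeff q N u (set vs) l * split_weight q u N B (remove1 l vs)
      = (\<Prod>c\<in>{1..N} - B. \<Prod>t\<in>set vs. u c - q * t) * (\<Prod>c\<in>{1..N} - B. \<Prod>b\<in>B. (q * u c - u b) / (u c - u b))
       * ((1 - q) * u (Suc N) * (\<Prod>b\<in>B. u b - q * l)
        * (\<Prod>j\<in>set vs - {l}. (u (Suc N) - j) * ((q * j - l) / (j - l))) * dwpf q (remove1 l vs) (u ` B))"
      unfolding last_row_coeff_def split_weight_def by (simp only: mult_ac)
  qed
qed

text \<open>
  The coefficient of \<open>\<Phi> (insert (Suc N) B)\<close> in the inductive step: up to common factors this is the expansion
  of the partition function along the row \<open>Suc N\<close>.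
\<close>
lemma split_weight_insert_last:
  assumes "admissible u vs" "B \<subseteq> {1..N}" "length vs = Suc (card B)"
  shows "split_weight q u (Suc N) (insert (Suc N) B) vs
    = exchange_coeff q u N B (Suc N) * (\<Sum>l\<in>set vs. last_row_coeff q N u (set vs) l * split_weight q u N B (remove1 l vs))"
proof -
  have diff: "{1..Suc N} - insert (Suc N) B = {1..N} - B" using assms(2) by auto
  have "finite B" "Suc N \<notin> B" using assms(2) finite_subset by auto
  then have phi: "(\<Prod>c\<in>{1..N} - B. \<Prod>a\<in>insert (Suc N) B. (q * u c - u a) / (u c - u a))
    = (\<Prod>c\<in>{1..N} - B. (q * u c - u (Suc N)) / (u c - u (Suc N)))
     * (\<Prod>c\<in>{1..N} - B. \<Prod>b\<in>B. (q * u c - u b) / (u c - u b))"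
    unfolding prod.distrib[symmetric] by (intro prod.cong refl prod.insert)
  have coeff: "exchange_coeff q u N B (Suc N) = (\<Prod>c\<in>{1..N} - B. (q * u c - u (Suc N)) / (u c - u (Suc N)))"
    unfolding exchange_coeff_def diff prod_dividef[symmetric] by (intro prod.cong refl quotient_flip)
  show ?thesis
    unfolding sum_last_row_coeff[OF assms] unfolding split_weight_def diff phi coeff image_insert
    by (simp only: mult_ac)
qed

text \<open>
  The coefficient of \<open>\<Phi> A\<close> with \<open>Suc N \<notin> A\<close> in the inductive step. The sum over \<open>l\<close> is the partition function
  with \<open>a\<close> replaced by the new row (\<open>sum_last_row_coeff\<close>), and \<open>dwpf_eliminate_row\<close> applies.
\<close>
lemma split_weight_without_last:
  assumes "admissible u vs" "A \<subseteq> {1..N}" "length vs = card A"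
  shows "split_weight q u (Suc N) A vs = (\<Prod>s\<in>set vs. q * (u (Suc N) - s)) * split_weight q u N A vs
    + (\<Sum>a\<in>A. exchange_coeff q u N (A - {a}) a * (\<Sum>l\<in>set vs. last_row_coeff q N u (set vs) l
        * split_weight q u N (A - {a}) (remove1 l vs)))"
proof -
  have vs: "distinct vs" "0 \<notin> set vs" "set vs \<inter> range u = {}"
    using assms(1) by (auto simp: admissible_def)
  have fin: "finite A" and new: "Suc N \<notin> A" using assms(2) finite_subset by auto
  have inj: "inj_on u A" using inj_u inj_on_subset by blast
  define C where "C = {1..N} - A"
  define P where "P = (\<Prod>c\<in>C. \<Prod>t\<in>set vs. u c - q * t) * (\<Prod>c\<in>C. \<Prod>a\<in>A. (q * u c - u a) / (u c - u a))"
  have diff: "{1..Suc N} - A = insert (Suc N) C" "Suc N \<notin> C" "finite C"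
    using new by (auto simp: C_def)
  have "split_weight q u (Suc N) A vs = P * ((\<Prod>t\<in>set vs. u (Suc N) - q * t)
      * (\<Prod>a\<in>A. (q * u (Suc N) - u a) / (u (Suc N) - u a)) * dwpf q vs (u ` A))"
    unfolding split_weight_def diff(1) prod.insert[OF diff(3,2)] P_def by (simp only: mult_ac)
  also have "(\<Prod>t\<in>set vs. u (Suc N) - q * t)
      * (\<Prod>a\<in>A. (q * u (Suc N) - u a) / (u (Suc N) - u a)) * dwpf q vs (u ` A)
    = q ^ length vs * (\<Prod>t\<in>set vs. u (Suc N) - t) * dwpf q vs (u ` A)
      + (\<Sum>a\<in>A. (1 - q) * u a / (u a - u (Suc N)) * (\<Prod>t\<in>set vs. u a - q * t)
        * (\<Prod>b\<in>A - {a}. (q * u a - u b) / (u a - u b)) * dwpf q vs (insert (u (Suc N)) (u ` (A - {a}))))"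
  proof -
    have "u (Suc N) \<notin> u ` A" using new inj_u by (auto dest: injD)
    moreover have "length vs = card (u ` A)" using assms(3) inj by (simp add: card_image)
    moreover have "u ` A - {u a} = u ` (A - {a})" "inj_on u (A - {a})" if "a \<in> A" for a
      using that inj by (auto simp: inj_on_def)
    moreover have "u ` A \<inter> set vs = {}" "0 \<notin> u ` A" using vs(3) u_nz by auto
    ultimately show ?thesis
      using dwpf_eliminate_row[OF vs(1) finite_imageI[OF fin] _ _ vs(2), of u "u (Suc N)" q] inj
      by (simp add: prod.reindex sum.reindex)
  qed
  also have "P * \<dots> = (\<Prod>s\<in>set vs. q * (u (Suc N) - s)) * split_weight q u N A vs
    + (\<Sum>a\<in>A. P * ((1 - q) * u a / (u a - u (Suc N)) * (\<Prod>t\<in>set vs. u a - q * t)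
        * (\<Prod>b\<in>A - {a}. (q * u a - u b) / (u a - u b)) * dwpf q vs (insert (u (Suc N)) (u ` (A - {a})))))"
    unfolding P_def split_weight_def C_def[symmetric] distrib_left sum_distrib_left prod.distrib
      prod_constant distinct_card[OF vs(1)]
    by (simp only: mult_ac)
  also have "(\<Sum>a\<in>A. P * ((1 - q) * u a / (u a - u (Suc N)) * (\<Prod>t\<in>set vs. u a - q * t)
        * (\<Prod>b\<in>A - {a}. (q * u a - u b) / (u a - u b)) * dwpf q vs (insert (u (Suc N)) (u ` (A - {a})))))
    = (\<Sum>a\<in>A. exchange_coeff q u N (A - {a}) a * (\<Sum>l\<in>set vs. last_row_coeff q N u (set vs) l
        * split_weight q u N (A - {a}) (remove1 l vs)))"
  proof (intro sum.cong refl)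
    fix a assume a: "a \<in> A"
    have len: "length vs = Suc (card (A - {a}))"
      unfolding assms(3) using card_Suc_Diff1[OF fin a] by (rule sym)
    have sub: "A - {a} \<subseteq> {1..N}" using assms(2) by auto
    have insert: "{1..N} - (A - {a}) = insert a C" "a \<notin> C" "insert a (A - {a}) = A"
      using a assms(2) by (auto simp: C_def)
    have "exchange_coeff q u N (A - {a}) a
        = (u a - q * u a) / (u a - u (Suc N)) * (\<Prod>c\<in>C. (u a - q * u c) / (u a - u c))"
      unfolding exchange_coeff_def insert(1,3) diff(1) prod.insert[OF diff(3) insert(2)] prod.insert[OF diff(3,2)]
        prod_dividef by simp
    also have "(\<Prod>c\<in>C. (u a - q * u c) / (u a - u c)) = (\<Prod>c\<in>C. (q * u c - u a) / (u c - u a))"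
      by (intro prod.cong refl quotient_flip)
    also have "u a - q * u a = (1 - q) * u a" by (simp add: algebra_simps)
    finally have coeff: "exchange_coeff q u N (A - {a}) a
        = (1 - q) * u a / (u a - u (Suc N)) * (\<Prod>c\<in>C. (q * u c - u a) / (u c - u a))" .
    have phi: "(\<Prod>c\<in>C. \<Prod>b\<in>A. (q * u c - u b) / (u c - u b)) = (\<Prod>c\<in>C. (q * u c - u a) / (u c - u a))
        * (\<Prod>c\<in>C. \<Prod>b\<in>A - {a}. (q * u c - u b) / (u c - u b))"
      unfolding prod.distrib[symmetric] using fin a by (intro prod.cong refl prod.remove)
    show "P * ((1 - q) * u a / (u a - u (Suc N)) * (\<Prod>t\<in>set vs. u a - q * t)
        * (\<Prod>b\<in>A - {a}. (q * u a - u b) / (u a - u b)) * dwpf q vs (insert (u (Suc N)) (u ` (A - {a}))))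
      = exchange_coeff q u N (A - {a}) a * (\<Sum>l\<in>set vs. last_row_coeff q N u (set vs) l
        * split_weight q u N (A - {a}) (remove1 l vs))"
      unfolding sum_last_row_coeff[OF assms(1) sub len] unfolding coeff insert(1) prod.insert[OF diff(3) insert(2)]
        P_def phi
      by (simp only: mult_ac)
  qed
  finally show ?thesis .
qed

text \<open>
  The induction needs all \<open>\<Phi>\<close>: a last entry of \<open>a\<close> is absorbed by passing from \<open>\<Phi>\<close> to
  \<open>\<Psi> B\<close>, the sum of \<open>\<Phi> (insert b B)\<close> over the possible last entries \<open>b\<close>, weighted with their
  exchange coefficients.
\<close>
theorem sum_paths_eq_sum_subsets:
  assumes "admissible u vs" "length vs = d"
  shows "(\<Sum>y\<in>incr_seqs d n. \<Sum>a\<in>dist_seqs d y.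
      path_weight q u d y a * Fbar_on q n u (set vs) y * \<Phi> (a ` {1..d}))
    = (\<Sum>A | A \<subseteq> {1..n} \<and> card A = d. split_weight q u n A vs * \<Phi> A)"
  using assms
proof (induction n arbitrary: d vs \<Phi>)
  case 0
  show ?case
  proof (cases d)
    case 0
    then have "{A. A \<subseteq> {1..0::nat} \<and> card A = d} = {{}}" by auto
    then show ?thesis using 0 \<open>length vs = d\<close>
      by (simp add: incr_seqs_0 dist_seqs_0 path_weight_def Fbar_on_def split_weight_def)
  next
    case (Suc e)
    have empty: "{A. A \<subseteq> {1..0::nat} \<and> card A = Suc e} = {}" by auto
    show ?thesis unfolding Suc empty incr_seqs_Suc_0 by (simp only: sum.empty)
  qed
next
  case (Suc N)
  show ?case
  proof (cases d)
    case 0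
    then have "{A. A \<subseteq> {1..Suc N} \<and> card A = d} = {{}}"
      using finite_subset by fastforce
    then show ?thesis using 0 \<open>length vs = d\<close>
      by (simp add: incr_seqs_0 dist_seqs_0 path_weight_def Fbar_on_def split_weight_def)
  next
    case d: (Suc e)
    have vs: "distinct vs" "length vs = Suc e" using Suc.prems d by (auto simp: admissible_def)
    have card_vs: "card (set vs) = Suc e" using vs distinct_card by metis
    define E where "E = last_row_coeff q N u (set vs)"
    define T where "T = (\<lambda>B. \<Sum>l\<in>set vs. E l * split_weight q u N B (remove1 l vs))"
    define \<Psi> where "\<Psi> = (\<lambda>B. \<Sum>b\<in>{1..Suc N} - B. exchange_coeff q u N B b * \<Phi> (insert b B))"
    have old: "(\<Sum>y\<in>incr_seqs (Suc e) N. \<Sum>a\<in>dist_seqs (Suc e) y.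
        path_weight q u (Suc e) y a * Fbar_on q (Suc N) u (set vs) y * \<Phi> (a ` {1..Suc e}))
      = (\<Sum>A | A \<subseteq> {1..N} \<and> card A = Suc e.
          (\<Prod>s\<in>set vs. q * (u (Suc N) - s)) * split_weight q u N A vs * \<Phi> A)"
    proof -
      have "Fbar_on q (Suc N) u (set vs) y = (\<Prod>s\<in>set vs. q * (u (Suc N) - s)) * Fbar_on q N u (set vs) y"
        if "y \<in> incr_seqs (Suc e) N" for y
        using incr_seqs_le[OF that] card_vs by (intro Fbar_on_Suc) auto
      then have "(\<Sum>y\<in>incr_seqs (Suc e) N. \<Sum>a\<in>dist_seqs (Suc e) y.
          path_weight q u (Suc e) y a * Fbar_on q (Suc N) u (set vs) y * \<Phi> (a ` {1..Suc e}))
        = (\<Prod>s\<in>set vs. q * (u (Suc N) - s)) * (\<Sum>y\<in>incr_seqs (Suc e) N. \<Sum>a\<in>dist_seqs (Suc e) y.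
          path_weight q u (Suc e) y a * Fbar_on q N u (set vs) y * \<Phi> (a ` {1..Suc e}))"
        unfolding sum_distrib_left by (intro sum.cong refl) (simp add: mult_ac)
      also have "\<dots> = (\<Prod>s\<in>set vs. q * (u (Suc N) - s))
          * (\<Sum>A | A \<subseteq> {1..N} \<and> card A = Suc e. split_weight q u N A vs * \<Phi> A)"
        unfolding Suc.IH[OF Suc.prems(1) vs(2)] ..
      finally show ?thesis by (simp only: sum_distrib_left mult.assoc)
    qed
    have new: "(\<Sum>y\<in>incr_seqs e N. \<Sum>a\<in>dist_seqs (Suc e) (y(Suc e := Suc N)).
        path_weight q u (Suc e) (y(Suc e := Suc N)) a
          * Fbar_on q (Suc N) u (set vs) (y(Suc e := Suc N)) * \<Phi> (a ` {1..Suc e}))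
      = (\<Sum>B | B \<subseteq> {1..N} \<and> card B = e. T B * \<Psi> B)"
    proof -
      have image: "(a(Suc e := b)) ` {1..Suc e} = insert b (a ` {1..e})" for a :: "nat \<Rightarrow> nat" and b
        unfolding atLeastAtMostSuc_conv[of 1 e, simplified] by auto
      have "(\<Sum>y\<in>incr_seqs e N. \<Sum>a\<in>dist_seqs (Suc e) (y(Suc e := Suc N)).
          path_weight q u (Suc e) (y(Suc e := Suc N)) a
            * Fbar_on q (Suc N) u (set vs) (y(Suc e := Suc N)) * \<Phi> (a ` {1..Suc e}))
        = (\<Sum>y\<in>incr_seqs e N. \<Sum>a\<in>dist_seqs e y. path_weight q u e y a
            * Fbar_on q (Suc N) u (set vs) (y(Suc e := Suc N)) * \<Psi> (a ` {1..e}))"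
        unfolding sum_dist_seqs_Suc path_weight_Suc image \<Psi>_def sum_distrib_left
        by (intro sum.cong refl) (simp only: mult_ac)
      also have "\<dots> = (\<Sum>y\<in>incr_seqs e N. \<Sum>a\<in>dist_seqs e y. \<Sum>l\<in>set vs. E l * (path_weight q u e y a
            * Fbar_on q N u (set (remove1 l vs)) y * \<Psi> (a ` {1..e})))"
      proof (intro sum.cong refl)
        fix y a assume "y \<in> incr_seqs e N"
        then have "Fbar_on q (Suc N) u (set vs) (y(Suc e := Suc N))
            = (\<Sum>l\<in>set vs. E l * Fbar_on q N u (set (remove1 l vs)) y)"
          unfolding E_def set_remove1_eq[OF vs(1)]
          using incr_seqs_le card_vs by (intro Fbar_on_at_last_row[OF q]) auto
        then show "path_weight q u e y a * Fbar_on q (Suc N) u (set vs) (y(Suc e := Suc N)) * \<Psi> (a ` {1..e})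
            = (\<Sum>l\<in>set vs. E l * (path_weight q u e y a
            * Fbar_on q N u (set (remove1 l vs)) y * \<Psi> (a ` {1..e})))"
          by (simp add: sum_distrib_left sum_distrib_right mult_ac)
      qed
      also have "\<dots> = (\<Sum>l\<in>set vs. E l * (\<Sum>y\<in>incr_seqs e N. \<Sum>a\<in>dist_seqs e y. path_weight q u e y a
            * Fbar_on q N u (set (remove1 l vs)) y * \<Psi> (a ` {1..e})))"
        unfolding sum_distrib_left
        by (rule trans[OF sum.cong[OF refl sum.swap] sum.swap])
      also have "\<dots> = (\<Sum>l\<in>set vs. E l * (\<Sum>B | B \<subseteq> {1..N} \<and> card B = e.
            split_weight q u N B (remove1 l vs) * \<Psi> B))"
      proof (intro sum.cong refl arg_cong2[where f = "(*)"] Suc.IH)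
        fix l assume "l \<in> set vs"
        then show "length (remove1 l vs) = e" using vs by (simp add: length_remove1)
        show "admissible u (remove1 l vs)"
          using Suc.prems(1) by (auto simp: admissible_def)
      qed
      also have "\<dots> = (\<Sum>B | B \<subseteq> {1..N} \<and> card B = e. T B * \<Psi> B)"
        unfolding sum_distrib_left T_def sum_distrib_right
        by (subst sum.swap) (simp only: mult.assoc)
      finally show ?thesis .
    qed
    have "(\<Sum>B | B \<subseteq> {1..N} \<and> card B = e. T B * \<Psi> B)
      = (\<Sum>B | B \<subseteq> {1..N} \<and> card B = e. exchange_coeff q u N B (Suc N) * T B * \<Phi> (insert (Suc N) B))
      + (\<Sum>B | B \<subseteq> {1..N} \<and> card B = e. \<Sum>b\<in>{1..N} - B. exchange_coeff q u N B b * T B * \<Phi> (insert b B))"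
      unfolding sum.distrib[symmetric]
    proof (intro sum.cong refl)
      fix B assume B: "B \<in> {B. B \<subseteq> {1..N} \<and> card B = e}"
      then have "{1..Suc N} - B = insert (Suc N) ({1..N} - B)" by auto
      then show "T B * \<Psi> B = exchange_coeff q u N B (Suc N) * T B * \<Phi> (insert (Suc N) B)
          + (\<Sum>b\<in>{1..N} - B. exchange_coeff q u N B b * T B * \<Phi> (insert b B))"
        unfolding \<Psi>_def by (simp add: sum_distrib_left distrib_left mult_ac)
    qed
    also have "(\<Sum>B | B \<subseteq> {1..N} \<and> card B = e. exchange_coeff q u N B (Suc N) * T B * \<Phi> (insert (Suc N) B))
      = (\<Sum>B | B \<subseteq> {1..N} \<and> card B = e. split_weight q u (Suc N) (insert (Suc N) B) vs * \<Phi> (insert (Suc N) B))"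
      unfolding T_def E_def using split_weight_insert_last[OF Suc.prems(1)] vs(2)
      by (intro sum.cong refl) simp
    also have "(\<Sum>B | B \<subseteq> {1..N} \<and> card B = e. \<Sum>b\<in>{1..N} - B. exchange_coeff q u N B b * T B * \<Phi> (insert b B))
      = (\<Sum>A | A \<subseteq> {1..N} \<and> card A = Suc e. \<Sum>a\<in>A. exchange_coeff q u N (A - {a}) a * T (A - {a}) * \<Phi> (insert a (A - {a})))"
      by (rule sum_subsets_insert) simp
    also have "\<dots> = (\<Sum>A | A \<subseteq> {1..N} \<and> card A = Suc e.
        (\<Sum>a\<in>A. exchange_coeff q u N (A - {a}) a * T (A - {a})) * \<Phi> A)"
      unfolding sum_distrib_right by (intro sum.cong refl) (simp add: insert_absorb)
    finally have new': "(\<Sum>B | B \<subseteq> {1..N} \<and> card B = e. T B * \<Psi> B) =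
        (\<Sum>B | B \<subseteq> {1..N} \<and> card B = e. split_weight q u (Suc N) (insert (Suc N) B) vs * \<Phi> (insert (Suc N) B))
        + (\<Sum>A | A \<subseteq> {1..N} \<and> card A = Suc e. (\<Sum>a\<in>A. exchange_coeff q u N (A - {a}) a * T (A - {a})) * \<Phi> A)" .
    have "(\<Sum>A | A \<subseteq> {1..N} \<and> card A = Suc e. split_weight q u (Suc N) A vs * \<Phi> A)
      = (\<Sum>A | A \<subseteq> {1..N} \<and> card A = Suc e.
          (\<Prod>s\<in>set vs. q * (u (Suc N) - s)) * split_weight q u N A vs * \<Phi> A)
      + (\<Sum>A | A \<subseteq> {1..N} \<and> card A = Suc e. (\<Sum>a\<in>A. exchange_coeff q u N (A - {a}) a * T (A - {a})) * \<Phi> A)"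
      unfolding sum.distrib[symmetric] T_def E_def
    proof (intro sum.cong refl, goal_cases)
      case (1 A)
      then have "split_weight q u (Suc N) A vs = (\<Prod>s\<in>set vs. q * (u (Suc N) - s)) * split_weight q u N A vs
        + (\<Sum>a\<in>A. exchange_coeff q u N (A - {a}) a * (\<Sum>l\<in>set vs. last_row_coeff q N u (set vs) l
        * split_weight q u N (A - {a}) (remove1 l vs)))"
        using vs(2) by (intro split_weight_without_last[OF Suc.prems(1)]) auto
      then show ?case by (simp only: distrib_right)
    qed
    then show ?thesis
      unfolding d sum_incr_seqs_Suc old new new' sum_subsets_atMost_Suc by simp
  qed
qed

end


section \<open>The expansion of F with occupied last sites\<close>

lemma F_full_tail:
  fixes q :: "'a::field"
  assumes "k \<le> n" "\<And>j. j \<in> {1..k} \<Longrightarrow> x j \<le> m"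
    and "inj u" "inj w"
  shows "F q (m + (n - k)) n u w (\<lambda>j. if j \<le> k then x j else m + (j - k))
    = (\<Sum>A | A \<subseteq> {1..n} \<and> card A = n - k. split_weight q u n A (map w [Suc m..<Suc (m + (n - k))])
        * ((\<Prod>a\<in>A. \<Prod>i\<in>{1..m}. u a - w i) * F_on q m k ({1..n} - A) u w x))"
proof -
  define d where "d = n - k"
  define \<phi> where "\<phi> = (\<lambda>i j. (q * u i - u j) / (u i - u j))"
  define x' where "x' = (\<lambda>j. if j \<le> k then x j else m + (j - k))"
  define g where "g = (\<lambda>x a. site_weight q (m + d) w x (u a))"
  have n: "n = k + d" using assms(1) by (simp add: d_def)
  have upt: "[1..<Suc n] = [1..<Suc k] @ [Suc k..<Suc n]"
    using upt_add_eq_append[of 1 "Suc k" d] n by simp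
  have first: "map (\<lambda>j. g (x' j)) [1..<Suc k] = map (\<lambda>j. g (x j)) [1..<Suc k]"
    by (intro map_cong) (auto simp: x'_def)
  have last: "map (\<lambda>j. g (x' j)) [Suc k..<Suc n] = map g [Suc m..<Suc (m + d)]"
    by (rule nth_equalityI) (auto simp: n x'_def simp del: upt_Suc)
  have "F q (m + d) n u w x' = symmetrization \<phi> (map (\<lambda>j. g (x j)) [1..<Suc k] @ map g [Suc m..<Suc (m + d)]) {1..n}"
    unfolding first[symmetric] last[symmetric] map_append[symmetric] upt[symmetric]
    unfolding F_eq_symmetrization \<phi>_def g_def ..
  also have "\<dots> = (\<Sum>B | B \<subseteq> {1..n} \<and> card B = k. symmetrization \<phi> (map (\<lambda>j. g (x j)) [1..<Suc k]) B
      * (\<Prod>b\<in>B. \<Prod>c\<in>{1..n} - B. \<phi> b c) * symmetrization \<phi> (map g [Suc m..<Suc (m + d)]) ({1..n} - B))"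
    unfolding symmetrization_append[OF finite_atLeastAtMost] by (simp del: upt_Suc)
  also have "\<dots> = (\<Sum>A | A \<subseteq> {1..n} \<and> card A = d. split_weight q u n A (map w [Suc m..<Suc (m + d)])
        * ((\<Prod>a\<in>A. \<Prod>i\<in>{1..m}. u a - w i) * F_on q m k ({1..n} - A) u w x))"
  proof (rule sum.reindex_bij_witness[where i = "\<lambda>A. {1..n} - A" and j = "\<lambda>B. {1..n} - B"], goal_cases)
    case (2 B)
    then show ?case using n finite_subset[of _ "{1..n}"] by (auto simp: card_Diff_subset)
  next
    case (4 A)
    then show ?case using n finite_subset[of _ "{1..n}"] by (auto simp: card_Diff_subset)
  next
    case (5 B)
    then have B: "finite B" "card B = k" "{1..n} - ({1..n} - B) = B"
      using finite_subset[of B "{1..n}"] by auto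
    have card: "m + card ({1..n} - B) = m + d"
      using 5 B n by (simp add: card_Diff_subset)
    have inj: "inj_on u ({1..n} - B)" "inj_on w {Suc m..m + d}"
      using assms(3,4) inj_on_subset by blast+
    have left: "symmetrization \<phi> (map (\<lambda>j. g (x j)) [1..<Suc k]) B
        = (\<Prod>b\<in>B. \<Prod>i\<in>{m + 1..m + d}. u b - q * w i) * F_on q m k B u w x"
    proof -
      have "symmetrization \<phi> (map (\<lambda>j. g (x j)) [1..<Suc k]) B = symmetrization \<phi>
          (map (\<lambda>j b. (\<Prod>i\<in>{m + 1..m + d}. u b - q * w i) * site_weight q m w (x j) (u b)) [1..<Suc k]) B"
        unfolding g_def using assms(2) by (intro symmetrization_cong site_weight_extend) auto
      then show ?thesis
        unfolding F_on_eq_symmetrization[OF B(1,2)] \<phi>_def[symmetric]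
        using B by (simp add: symmetrization_weight del: upt_Suc)
    qed
    have right: "symmetrization \<phi> (map g [Suc m..<Suc (m + d)]) ({1..n} - B)
        = (\<Prod>a\<in>{1..n} - B. \<Prod>i\<in>{1..m}. u a - w i) * dwpf q (map w [Suc m..<Suc (m + d)]) (u ` ({1..n} - B))"
      unfolding g_def \<phi>_def by (rule symmetrization_consecutive_sites[OF _ card inj]) simp
    have set: "set (map w [Suc m..<Suc (m + d)]) = w ` {m + 1..m + d}"
      by auto
    have inj': "inj_on w {m + 1..m + d}" using inj(2) by simp
    show ?case
      unfolding left right
      unfolding split_weight_def B(3) set prod.reindex[OF inj'] comp_def \<phi>_def
      by (simp only: mult_ac)
  qed auto
  finally show ?thesis unfolding d_def x'_def .
qed

text \<open>
  The identity at generic values in a field: the interpolation takes place at the values of \<open>u\<close> and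
  \<open>w\<close> and at 0, which therefore have to be distinct, and the kernel of \<open>Fbar\<close> divides by \<open>q\<close>.
\<close>
theorem F_full_tail_expansion:
  fixes q :: "'a::field"
  assumes "k \<le> n" "\<And>j. j \<in> {1..k} \<Longrightarrow> x j \<le> m"
    and "q \<noteq> 0" "inj u" "inj w" "0 \<notin> range u" "0 \<notin> range w" "range u \<inter> range w = {}"
  shows "F q (m + (n - k)) n u w (\<lambda>j. if j \<le> k then x j else m + (j - k)) =
      (\<Sum>y\<in>incr_seqs (n - k) n. \<Sum>a\<in>dist_seqs (n - k) y.
         (\<Prod>j\<in>{1..n - k}. \<Prod>i\<in>{1..m}. u (a j) - w i)
       * ((\<Prod>j\<in>{1..n - k}. \<Prod>b\<in>{1..<y j} - a ` {1..<j}. u (a j) - q * u b)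
          / (\<Prod>j\<in>{1..n - k}. \<Prod>b\<in>{1..y j} - a ` {1..j}. u (a j) - u b))
       * Fbar q n (n - k) (\<lambda>j. w (m + j)) u y
       * F_on q m k ({1..n} - a ` {1..n - k}) u w x)"
proof -
  define d where "d = n - k"
  define vs where "vs = map w [Suc m..<Suc (m + d)]"
  define \<Phi> where "\<Phi> = (\<lambda>A. (\<Prod>a\<in>A. \<Prod>i\<in>{1..m}. u a - w i) * F_on q m k ({1..n} - A) u w x)"
  have "inj_on w {Suc m..<Suc (m + d)}" using assms(5) inj_on_subset by blast
  then have vs: "admissible u vs" "length vs = d"
    using assms(7,8) unfolding admissible_def vs_def
    by (auto simp: distinct_map simp del: upt_Suc)
  have set_vs: "set vs = (\<lambda>j. w (m + j)) ` {1..d}"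
  proof -
    have "set vs = w ` {m + 1..m + d}" unfolding vs_def by auto
    also have "{m + 1..m + d} = (\<lambda>j. m + j) ` {1..d}"
      by (subst image_add_atLeastAtMost) simp
    finally show ?thesis by (simp only: image_image)
  qed
  have "inj_on (\<lambda>j. w (m + j)) {1..d}"
    using assms(5) by (intro inj_onI) (auto dest: injD)
  then have Fbar: "Fbar q n d (\<lambda>j. w (m + j)) u y = Fbar_on q n u (set vs) y" for y
    unfolding set_vs by (rule Fbar_eq_Fbar_on)
  have "F q (m + d) n u w (\<lambda>j. if j \<le> k then x j else m + (j - k))
      = (\<Sum>A | A \<subseteq> {1..n} \<and> card A = d. split_weight q u n A vs * \<Phi> A)"
    unfolding d_def vs_def \<Phi>_def by (rule F_full_tail[OF assms(1,2,4,5)])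
  also have "\<dots> = (\<Sum>y\<in>incr_seqs d n. \<Sum>a\<in>dist_seqs d y.
      path_weight q u d y a * Fbar_on q n u (set vs) y * \<Phi> (a ` {1..d}))"
    by (rule sum_paths_eq_sum_subsets[OF assms(3,4,6) vs, symmetric])
  also have "\<dots> = (\<Sum>y\<in>incr_seqs d n. \<Sum>a\<in>dist_seqs d y.
         (\<Prod>j\<in>{1..d}. \<Prod>i\<in>{1..m}. u (a j) - w i) * path_weight q u d y a
       * Fbar q n d (\<lambda>j. w (m + j)) u y * F_on q m k ({1..n} - a ` {1..d}) u w x)"
  proof (intro sum.cong refl)
    fix y a assume "a \<in> dist_seqs d y"
    then have "inj_on a {1..d}" by (simp add: dist_seqs_def)
    then show "path_weight q u d y a * Fbar_on q n u (set vs) y * \<Phi> (a ` {1..d})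
        = (\<Prod>j\<in>{1..d}. \<Prod>i\<in>{1..m}. u (a j) - w i) * path_weight q u d y a
       * Fbar q n d (\<lambda>j. w (m + j)) u y * F_on q m k ({1..n} - a ` {1..d}) u w x"
      unfolding \<Phi>_def Fbar by (simp add: prod.reindex mult_ac)
  qed
  finally show ?thesis unfolding path_weight_def d_def .
qed

lemma indet_eq_iff: "(indet v :: 'c::field ratfun) = indet v' \<longleftrightarrow> v = v'"
proof
  assume "(indet v :: 'c ratfun) = indet v'"
  then have "Poly_Mapping.single (Poly_Mapping.single v (1::nat)) (1::'c)
      = Poly_Mapping.single (Poly_Mapping.single v' 1) 1"
    by (simp add: indet_def eq_fract)
  then have "Poly_Mapping.keys (Poly_Mapping.single (Poly_Mapping.single v (1::nat)) (1::'c))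
      = Poly_Mapping.keys (Poly_Mapping.single (Poly_Mapping.single v' (1::nat)) (1::'c))"
    by (rule arg_cong)
  then have "Poly_Mapping.keys (Poly_Mapping.single v (1::nat)) = Poly_Mapping.keys (Poly_Mapping.single v' (1::nat))"
    by simp
  then show "v = v'" by simp
qed simp

lemma indet_nonzero: "(indet v :: 'c::field ratfun) \<noteq> 0"
proof
  assume "(indet v :: 'c ratfun) = 0"
  then have "Poly_Mapping.single (Poly_Mapping.single v (1::nat)) (1::'c) = 0"
    by (simp add: indet_def Zero_fract_def eq_fract)
  then have "Poly_Mapping.keys (Poly_Mapping.single (Poly_Mapping.single v (1::nat)) (1::'c)) = {}"
    by (simp only: keys_zero)
  then show False by simp
qed

theorem mainTheorem3:
  fixes m n k :: nat
    and x :: "nat \<Rightarrow> nat"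
    and q :: "'c::field ratfun"
    and u w :: "nat \<Rightarrow> 'c ratfun"
  assumes "1 \<le> m" and "1 \<le> n" and "k \<le> min m n"
    and "x \<in> {1..k} \<rightarrow> {1..m}" and "strict_mono_on {1..k} x"
    and "q = indet Q" and "u = (\<lambda>i. indet (U i))" and "w = (\<lambda>i. indet (W i))"
  shows
    "F q (m + n - k) n u w (\<lambda>j. if j \<le> k then x j else m + (j - k)) =
      (\<Sum>y\<in>incr_seqs (n - k) n. \<Sum>a\<in>dist_seqs (n - k) y.
         (\<Prod>j\<in>{1..n - k}. \<Prod>i\<in>{1..m}. u (a j) - w i)
       * ((\<Prod>j\<in>{1..n - k}. \<Prod>b\<in>{1..<y j} - a ` {1..<j}. u (a j) - q * u b)
          / (\<Prod>j\<in>{1..n - k}. \<Prod>b\<in>{1..y j} - a ` {1..j}. u (a j) - u b))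
       * Fbar q n (n - k) (\<lambda>j. w (m + j)) u y
       * F_on q m k ({1..n} - a ` {1..n - k}) u w x)"
proof -
  have sites: "m + n - k = m + (n - k)" and "k \<le> n" using assms(3) by auto
  show ?thesis
    unfolding sites
  proof (rule F_full_tail_expansion)
    show "k \<le> n" by fact
    show "x j \<le> m" if "j \<in> {1..k}" for j using assms(4) that by auto
    show "q \<noteq> 0" using assms(6) indet_nonzero by simp
    show "inj u" "inj w" using assms(7,8) by (auto simp: inj_on_def indet_eq_iff)
    show "0 \<notin> range u" "0 \<notin> range w"
      using assms(7,8) by (metis indet_nonzero rangeE)+
    show "range u \<inter> range w = {}" using assms(7,8) by (auto simp: indet_eq_iff)
  qed
qed

end
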